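(* Let $(\mathcal V,\mathcal E)$ be a finite connected directed graph with at least one boundary vertex ($\mathcal V_\partial\neq\emptyset$), with edge lengths $0<l^e<\infty$ for $e\in\mathcal E$, and let $a,b,c\in L^2(\mathcal E)$ satisfy $C_0\le a,b,c\le C_1$ a.e. on $\mathcal E$ for some constants $C_0,C_1>0$. Then for any $\bar f,\bar g\in L^2(\mathcal E)$ the stationary problem $$\partial_x\bar p^e+a^e\bar u^e=\bar f^e,\qquad \partial_x\bar u^e=\bar g^e\qquad\text{on every } e\in\mathcal E,$$ with the conditions $\bar p^e(v)=\bar p^{e'}(v)$ for all $e,e'\in\mathcal E(v)$, $v\in\mathcal V_0$; $\sum_{e\in\mathcal E(v)}n^e(v)\bar u^e(v)=0$ for all $v\in\mathcal V_0$; and $\bar p^e(v)=0$ for all $v\in\mathcal V_\partial$, $e\in\mathcal E(v)$, has a unique solution $(\bar u,\bar p)\in H(\mathrm{div})\times H^1_0$, and $$\|\bar u\|_{H(\mathrm{div})}+\|\bar p\|_{H^1}\le C\big(\|\bar f\|_{L^2}+\|\bar g\|_{L^2}\big)$$ with a constant $C$ independent of $\bar f,\bar g$.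
   Context: Network notation: $\mathcal E\subset\mathcal V\times\mathcal V$, the two end vertices of each edge being distinct; connectedness ignores edge orientation. $\mathcal E(v)$ is the set of edges having $v$ as an end vertex; $\mathcal V_0=\{v:|\mathcal E(v)|\ge2\}$ are the interior vertices and $\mathcal V_\partial=\mathcal V\setminus\mathcal V_0$ the boundary vertices. For $e\in\mathcal E$: $n^e(v)=-1$ if $e=(v,\cdot)$, $n^e(v)=1$ if $e=(\cdot,v)$, and $n^e(v)=0$ otherwise. Each edge $e=(v_l,v_r)$ is identified with the interval $[0,l^e]$, $v_l$ with $0$ and $v_r$ with $l^e$; for a function $w$ on the network, $w^e=w|_e$ and $w^e(v)$ is the value (trace) of $w^e$ at the endpoint corresponding to $v$. Function spaces: $L^2=L^2(\mathcal E)=\{w: w^e\in L^2(e)\ \forall e\}$ with $(w,z)_{\mathcal E}=\sum_e(w^e,z^e)_{L^2(e)}$ and norm $\|\cdot\|_{L^2}$; $H^1(\mathcal E)=\{w: w^e\in H^1(e)\ \forall e\}$; $\partial_x' w$ is the edgewise derivative, $(\partial_x' w)|_e=\partial_x w^e$. $H^1_0=\{p\in H^1(\mathcal E): p^e(v)=p^{e'}(v)\ \forall e,e'\in\mathcal E(v),v\in\mathcal V_0;\ p^e(v)=0\ \forall v\in\mathcal V_\partial, e\in\mathcal E(v)\}$. $H(\mathrm{div})=\{u\in H^1(\mathcal E):\sum_{e\in\mathcal E(v)}n^e(v)u^e(v)=0\ \forall v\in\mathcal V_0\}$. Both carry the norm $(\|w\|_{L^2}^2+\|\partial_x' w\|_{L^2}^2)^{1/2}$,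 written $\|\cdot\|_{H^1}$ and $\|\cdot\|_{H(\mathrm{div})}$ respectively. *)

theory Defs
  imports
    "HOL-Analysis.Analysis"
    "Graph_Theory.Pair_Digraph"
    "Graph_Theory.Digraph_Component"
begin

text \<open>
  A function on the network is a family \<open>w :: 'v \<times> 'v \<Rightarrow> real \<Rightarrow> real\<close>; only the values
  \<open>w e x\<close> with \<open>e \<in> parcs G\<close> and \<open>0 \<le> x \<le> len e\<close> matter.  Elements of \<open>L\<^sup>2\<close> and \<open>H\<^sup>1\<close> are
  represented by arbitrary representatives of their classes modulo equality almost everywhere, so
  equality of network functions is \<open>network_eq\<close> below.
\<close>

subsection \<open>\<open>L\<^sup>2\<close> and \<open>H\<^sup>1\<close> on an interval\<close>

definition L2_interval :: "real \<Rightarrow> (real \<Rightarrow> real) set" where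
  "L2_interval l = {w \<in> borel_measurable (lebesgue_on {0..l}).
     integrable (lebesgue_on {0..l}) (\<lambda>x. (w x)\<^sup>2)}"

text \<open>
  As in Brezis, "Functional Analysis, Sobolev Spaces and Partial Differential Equations",
  Section 8.2, the test functions on an open interval are the \<open>C\<^sup>1\<close> functions with compact
  support; they give the same weak derivatives as smooth ones.
\<close>

definition test_function :: "real \<Rightarrow> (real \<Rightarrow> real) \<Rightarrow> bool" where
  "test_function l \<phi> \<longleftrightarrow> \<phi> C1_differentiable_on UNIV \<and> closure {x. \<phi> x \<noteq> 0} \<subseteq> {0<..<l}"

definition has_weak_deriv :: "real \<Rightarrow> (real \<Rightarrow> real) \<Rightarrow> (real \<Rightarrow> real) \<Rightarrow> bool" where
  "has_weak_deriv l w g \<longleftrightarrow> (\<forall>\<phi>. test_function l \<phi> \<longrightarrow>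
     (LINT x|lebesgue_on {0..l}. w x * deriv \<phi> x) = - (LINT x|lebesgue_on {0..l}. g x * \<phi> x))"

definition H1_interval :: "real \<Rightarrow> (real \<Rightarrow> real) set" where
  "H1_interval l = {w \<in> L2_interval l. \<exists>g \<in> L2_interval l. has_weak_deriv l w g}"

text \<open>The weak derivative of \<open>w \<in> H1_interval l\<close>, determined up to a null set.\<close>

definition weak_deriv :: "real \<Rightarrow> (real \<Rightarrow> real) \<Rightarrow> real \<Rightarrow> real" where
  "weak_deriv l w = (SOME g. g \<in> L2_interval l \<and> has_weak_deriv l w g)"

text \<open>The trace is the value of the continuous representative.\<close>

definition interval_trace :: "real \<Rightarrow> (real \<Rightarrow> real) \<Rightarrow> real \<Rightarrow> real" where
  "interval_trace l w x = (THE t. \<exists>w'. continuous_on {0..l} w' \<and>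
     (AE y in lebesgue_on {0..l}. w' y = w y) \<and> w' x = t)"


subsection \<open>The network\<close>

definition incident_edges :: "'v pair_pre_digraph \<Rightarrow> 'v \<Rightarrow> ('v \<times> 'v) set" where
  "incident_edges G v = {e \<in> parcs G. fst e = v \<or> snd e = v}"

definition interior_vertices :: "'v pair_pre_digraph \<Rightarrow> 'v set" where
  "interior_vertices G = {v \<in> pverts G. card (incident_edges G v) \<ge> 2}"

definition boundary_vertices :: "'v pair_pre_digraph \<Rightarrow> 'v set" where
  "boundary_vertices G = pverts G - interior_vertices G"

definition edge_sign :: "'v \<times> 'v \<Rightarrow> 'v \<Rightarrow> real" where
  "edge_sign e v = (if fst e = v then - 1 else if snd e = v then 1 else 0)"

text \<open>\<open>w\<^sup>e(v)\<close>, used only for \<open>e \<in> incident_edges G v\<close>: the tail sits at \<open>0\<close>, the head at \<open>len e\<close>.\<close>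

definition vertex_value ::
    "('v \<times> 'v \<Rightarrow> real) \<Rightarrow> ('v \<times> 'v \<Rightarrow> real \<Rightarrow> real) \<Rightarrow> 'v \<times> 'v \<Rightarrow> 'v \<Rightarrow> real" where
  "vertex_value len w e v = interval_trace (len e) (w e) (if fst e = v then 0 else len e)"


subsection \<open>Function spaces on the network\<close>

definition L2_network ::
    "'v pair_pre_digraph \<Rightarrow> ('v \<times> 'v \<Rightarrow> real) \<Rightarrow> ('v \<times> 'v \<Rightarrow> real \<Rightarrow> real) set" where
  "L2_network G len = {w. \<forall>e \<in> parcs G. w e \<in> L2_interval (len e)}"

definition L2_inner :: "'v pair_pre_digraph \<Rightarrow> ('v \<times> 'v \<Rightarrow> real) \<Rightarrow>
    ('v \<times> 'v \<Rightarrow> real \<Rightarrow> real) \<Rightarrow> ('v \<times> 'v \<Rightarrow> real \<Rightarrow> real) \<Rightarrow> real" where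
  "L2_inner G len w z = (\<Sum>e \<in> parcs G. LINT x|lebesgue_on {0..len e}. w e x * z e x)"

definition L2_norm ::
    "'v pair_pre_digraph \<Rightarrow> ('v \<times> 'v \<Rightarrow> real) \<Rightarrow> ('v \<times> 'v \<Rightarrow> real \<Rightarrow> real) \<Rightarrow> real" where
  "L2_norm G len w = sqrt (L2_inner G len w w)"

definition H1_network ::
    "'v pair_pre_digraph \<Rightarrow> ('v \<times> 'v \<Rightarrow> real) \<Rightarrow> ('v \<times> 'v \<Rightarrow> real \<Rightarrow> real) set" where
  "H1_network G len = {w. \<forall>e \<in> parcs G. w e \<in> H1_interval (len e)}"

definition edgewise_deriv ::
    "('v \<times> 'v \<Rightarrow> real) \<Rightarrow> ('v \<times> 'v \<Rightarrow> real \<Rightarrow> real) \<Rightarrow> 'v \<times> 'v \<Rightarrow> real \<Rightarrow> real" where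
  "edgewise_deriv len w e = weak_deriv (len e) (w e)"

definition H1_norm ::
    "'v pair_pre_digraph \<Rightarrow> ('v \<times> 'v \<Rightarrow> real) \<Rightarrow> ('v \<times> 'v \<Rightarrow> real \<Rightarrow> real) \<Rightarrow> real" where
  "H1_norm G len w = sqrt ((L2_norm G len w)\<^sup>2 + (L2_norm G len (edgewise_deriv len w))\<^sup>2)"

text \<open>The norm of \<open>H(div)\<close> is given by the same expression.\<close>

abbreviation (input) Hdiv_norm ::
    "'v pair_pre_digraph \<Rightarrow> ('v \<times> 'v \<Rightarrow> real) \<Rightarrow> ('v \<times> 'v \<Rightarrow> real \<Rightarrow> real) \<Rightarrow> real" where
  "Hdiv_norm \<equiv> H1_norm"

definition network_eq :: "'v pair_pre_digraph \<Rightarrow> ('v \<times> 'v \<Rightarrow> real) \<Rightarrow>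
    ('v \<times> 'v \<Rightarrow> real \<Rightarrow> real) \<Rightarrow> ('v \<times> 'v \<Rightarrow> real \<Rightarrow> real) \<Rightarrow> bool" where
  "network_eq G len w z \<longleftrightarrow> (\<forall>e \<in> parcs G. AE x in lebesgue_on {0..len e}. w e x = z e x)"

definition continuous_at_interior ::
    "'v pair_pre_digraph \<Rightarrow> ('v \<times> 'v \<Rightarrow> real) \<Rightarrow> ('v \<times> 'v \<Rightarrow> real \<Rightarrow> real) \<Rightarrow> bool" where
  "continuous_at_interior G len p \<longleftrightarrow> (\<forall>v \<in> interior_vertices G.
     \<forall>e \<in> incident_edges G v. \<forall>e' \<in> incident_edges G v.
       vertex_value len p e v = vertex_value len p e' v)"

definition zero_at_boundary ::
    "'v pair_pre_digraph \<Rightarrow> ('v \<times> 'v \<Rightarrow> real) \<Rightarrow> ('v \<times> 'v \<Rightarrow> real \<Rightarrow> real) \<Rightarrow> bool" where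
  "zero_at_boundary G len p \<longleftrightarrow> (\<forall>v \<in> boundary_vertices G.
     \<forall>e \<in> incident_edges G v. vertex_value len p e v = 0)"

definition flux_balanced ::
    "'v pair_pre_digraph \<Rightarrow> ('v \<times> 'v \<Rightarrow> real) \<Rightarrow> ('v \<times> 'v \<Rightarrow> real \<Rightarrow> real) \<Rightarrow> bool" where
  "flux_balanced G len u \<longleftrightarrow> (\<forall>v \<in> interior_vertices G.
     (\<Sum>e \<in> incident_edges G v. edge_sign e v * vertex_value len u e v) = 0)"

definition H10 ::
    "'v pair_pre_digraph \<Rightarrow> ('v \<times> 'v \<Rightarrow> real) \<Rightarrow> ('v \<times> 'v \<Rightarrow> real \<Rightarrow> real) set" where
  "H10 G len = {p \<in> H1_network G len. continuous_at_interior G len p \<and> zero_at_boundary G len p}"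

definition Hdiv ::
    "'v pair_pre_digraph \<Rightarrow> ('v \<times> 'v \<Rightarrow> real) \<Rightarrow> ('v \<times> 'v \<Rightarrow> real \<Rightarrow> real) set" where
  "Hdiv G len = {u \<in> H1_network G len. flux_balanced G len u}"


subsection \<open>The stationary problem\<close>

definition stationary_solution :: "'v pair_pre_digraph \<Rightarrow> ('v \<times> 'v \<Rightarrow> real) \<Rightarrow>
    ('v \<times> 'v \<Rightarrow> real \<Rightarrow> real) \<Rightarrow> ('v \<times> 'v \<Rightarrow> real \<Rightarrow> real) \<Rightarrow> ('v \<times> 'v \<Rightarrow> real \<Rightarrow> real) \<Rightarrow>
    ('v \<times> 'v \<Rightarrow> real \<Rightarrow> real) \<Rightarrow> ('v \<times> 'v \<Rightarrow> real \<Rightarrow> real) \<Rightarrow> bool" where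
  "stationary_solution G len a f g u p \<longleftrightarrow>
     (\<forall>e \<in> parcs G. AE x in lebesgue_on {0..len e}.
        edgewise_deriv len p e x + a e x * u e x = f e x) \<and>
     (\<forall>e \<in> parcs G. AE x in lebesgue_on {0..len e}. edgewise_deriv len u e x = g e x) \<and>
     continuous_at_interior G len p \<and> flux_balanced G len u \<and> zero_at_boundary G len p"

end

theory Submission
  imports Defs "Jordan_Normal_Form.Determinant"
begin

text \<open>
  On a single edge the equations integrate explicitly: the flow is its inflow plus the integral of
  \<open>g\<close>, and the pressure is its value at the tail plus the integral of \<open>f - a u\<close>.  Eliminating the
  inflows in favour of the vertex pressures, flux balance becomes a linear system for the pressures
  at the interior vertices whose matrix is the graph Laplacian with conductances \<open>1 / \<integral> a\<close> and
  Dirichlet conditions at the boundary vertices.  By the energy identity and connectedness its kernel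
  is trivial, so it is invertible, and the norm of the inverse yields the stability constant.  That
  every weak solution arises in this way is the lemma of du Bois-Reymond.
\<close>

subsection \<open>Square-integrable functions on an interval\<close>

text \<open>On an edge the equations leave only two free constants, the inflow and the pressure at
  the tail, so a problem on infinite-dimensional spaces collapses to finitely many unknowns and no
  saddle-point theory is required. For a square system a trivial kernel already gives solvability,
  so the energy identity serves existence and uniqueness alike. A boundary vertex matters there:
  otherwise constant pressures would lie in the kernel. The obstacle is that network functions are
  representatives modulo null sets: \<open>weak_deriv\<close> is an arbitrary choice and a trace is
  defined only through a continuous representative. Everything is therefore computed with continuous
  primitives, whose traces are point values. Uniqueness comes from showing that every solution is
  built from such primitives, not from testing the weak equations. The right inverse of the system
  is fixed before the data. Its bound, and with it the final constant, depends only on the graph,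
  the lengths, \<open>a\<close> and its upper bound.\<close>

lemma AE_lebesgue_on_Icc_iff:
  fixes l :: real
  shows "(AE x in lebesgue_on {0..l}. P x) \<longleftrightarrow> (AE x in lebesgue. x \<in> {0..l} \<longrightarrow> P x)"
  by (rule AE_restrict_space_iff) simp

text \<open>The endpoints are joined to the null set, so that arguments available only at interior
  points, such as those at Lebesgue points, suffice.\<close>

lemma AE_lebesgue_on_negligibleI:
  fixes l :: real
  assumes "negligible N" "\<And>x. x \<in> {0<..<l} \<Longrightarrow> x \<notin> N \<Longrightarrow> P x"
  shows "AE x in lebesgue_on {0..l}. P x"
proof -
  have "negligible (N \<union> {0, l})"
    using assms(1) by (intro negligible_Un) auto
  then have "AE x in lebesgue. x \<notin> N \<union> {0, l}"
    by (intro AE_not_in) (simp add: negligible_iff_null_sets)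
  then show ?thesis
    unfolding AE_lebesgue_on_Icc_iff by eventually_elim (use assms(2) in force)
qed

text \<open>The coincidence set is closed and has full measure in the open interval, so it contains
  that interval and its closure. Reaching the endpoints is what makes traces well defined;
  \<open>0 < l\<close> excludes the degenerate interval, where equality almost everywhere says
  nothing.\<close>

lemma continuous_AE_eq_imp_eq:
  fixes v w :: "real \<Rightarrow> real"
  assumes "0 < l" "continuous_on {0..l} v" "continuous_on {0..l} w"
    and ae: "AE x in lebesgue_on {0..l}. v x = w x" and x: "x \<in> {0..l}"
  shows "v x = w x"
proof -
  define C where "C = {x \<in> {0..l}. v x - w x = 0}"
  have C: "closed C"
    unfolding C_def by (intro continuous_closed_preimage_constant continuous_intros assms closed_atLeastAtMost)
  have "AE x \<in> {0<..<l} in lebesgue. x \<in> C"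
    using ae unfolding AE_lebesgue_on_Icc_iff C_def by eventually_elim auto
  then have "{0<..<l} \<subseteq> C"
    using mem_closed_if_AE_lebesgue_open[OF open_greaterThanLessThan C] by blast
  then have "closure {0<..<l} \<subseteq> C"
    using C by (simp add: closure_minimal)
  then show ?thesis
    using x \<open>0 < l\<close> by (auto simp: C_def)
qed

lemma integrable_mult_L2_interval:
  assumes "v \<in> L2_interval l" "w \<in> L2_interval l"
  shows "integrable (lebesgue_on {0..l}) (\<lambda>x. v x * w x)"
proof (rule Bochner_Integration.integrable_bound)
  show "integrable (lebesgue_on {0..l}) (\<lambda>x. (v x)\<^sup>2 + (w x)\<^sup>2)"
    using assms by (auto simp: L2_interval_def)
  show "(\<lambda>x. v x * w x) \<in> borel_measurable (lebesgue_on {0..l})"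
    using assms by (auto simp: L2_interval_def)
  have "\<bar>v x * w x\<bar> \<le> (v x)\<^sup>2 + (w x)\<^sup>2" for x
  proof -
    have "0 \<le> (\<bar>v x\<bar> - \<bar>w x\<bar>)\<^sup>2 + (v x)\<^sup>2 + (w x)\<^sup>2" by simp
    then show ?thesis by (simp add: power2_diff abs_mult)
  qed
  then show "AE x in lebesgue_on {0..l}. norm (v x * w x) \<le> norm ((v x)\<^sup>2 + (w x)\<^sup>2)"
    by simp
qed

lemma L2_interval_cmult:
  assumes "w \<in> L2_interval l"
  shows "(\<lambda>x. c * w x) \<in> L2_interval l"
  using assms by (auto simp: L2_interval_def power_mult_distrib)

lemma L2_interval_add:
  assumes "v \<in> L2_interval l" "w \<in> L2_interval l"
  shows "(\<lambda>x. v x + w x) \<in> L2_interval l"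
  using assms integrable_mult_L2_interval[OF assms]
  by (auto simp: L2_interval_def power2_sum mult.assoc)

lemma L2_interval_diff:
  assumes "v \<in> L2_interval l" "w \<in> L2_interval l"
  shows "(\<lambda>x. v x - w x) \<in> L2_interval l"
  using L2_interval_add[OF assms(1) L2_interval_cmult[OF assms(2), of "-1"]] by simp

lemma L2_interval_continuous:
  assumes "continuous_on {0..l} w"
  shows "w \<in> L2_interval l"
proof -
  have "integrable (lebesgue_on {0..l}) (\<lambda>x. (w x)\<^sup>2)"
    by (intro continuous_imp_integrable_real continuous_intros assms)
  then show ?thesis
    using assms by (auto simp: L2_interval_def intro: continuous_imp_measurable_on_sets_lebesgue)
qed

lemma L2_interval_integrable:
  assumes "w \<in> L2_interval l"
  shows "integrable (lebesgue_on {0..l}) w"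
  using integrable_mult_L2_interval[OF assms, of "\<lambda>_. 1"] L2_interval_continuous[of l "\<lambda>_. 1"]
  by simp

lemma L2_interval_mult_bounded:
  assumes a: "a \<in> borel_measurable (lebesgue_on {0..l})" "AE x in lebesgue_on {0..l}. \<bar>a x\<bar> \<le> C"
    and w: "w \<in> L2_interval l"
  shows "(\<lambda>x. a x * w x) \<in> L2_interval l"
proof -
  have "integrable (lebesgue_on {0..l}) (\<lambda>x. (a x * w x)\<^sup>2)"
  proof (rule Bochner_Integration.integrable_bound)
    show "integrable (lebesgue_on {0..l}) (\<lambda>x. C\<^sup>2 * (w x)\<^sup>2)"
      using w by (auto simp: L2_interval_def)
    show "(\<lambda>x. (a x * w x)\<^sup>2) \<in> borel_measurable (lebesgue_on {0..l})"
      using a w by (auto simp: L2_interval_def)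
    show "AE x in lebesgue_on {0..l}. norm ((a x * w x)\<^sup>2) \<le> norm (C\<^sup>2 * (w x)\<^sup>2)"
      using a(2)
    proof eventually_elim
      case (elim x)
      then have "(a x)\<^sup>2 \<le> C\<^sup>2" by (simp add: abs_le_square_iff[symmetric])
      then show ?case by (simp add: power_mult_distrib mult_right_mono)
    qed
  qed
  then show ?thesis using a w by (auto simp: L2_interval_def)
qed

text \<open>The variance of \<open>\<bar>w\<bar>\<close> is nonnegative.\<close>

lemma abs_integral_le_L2:
  assumes "0 < l" "w \<in> L2_interval l"
  shows "(LINT x|lebesgue_on {0..l}. \<bar>w x\<bar>)\<^sup>2 \<le> l * (LINT x|lebesgue_on {0..l}. (w x)\<^sup>2)"
proof -
  let ?M = "lebesgue_on {0..l}"
  define I m where "I = (LINT x|?M. \<bar>w x\<bar>)" and "m = I / l"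
  have i: "integrable ?M (\<lambda>x. \<bar>w x\<bar>)" "integrable ?M (\<lambda>x. (w x)\<^sup>2)"
    using L2_interval_integrable[OF assms(2)] assms(2) unfolding L2_interval_def by simp_all
  have "0 \<le> (LINT x|?M. (\<bar>w x\<bar> - m)\<^sup>2)" by simp
  also have "\<dots> = (LINT x|?M. (w x)\<^sup>2 + m\<^sup>2 - 2 * m * \<bar>w x\<bar>)"
    by (intro Bochner_Integration.integral_cong) (simp_all add: power2_diff)
  also have "\<dots> = (LINT x|?M. (w x)\<^sup>2) + m\<^sup>2 * l - 2 * m * I"
    using i assms(1) by (simp add: I_def measure_restrict_space)
  finally have "0 \<le> l * ((LINT x|?M. (w x)\<^sup>2) + m\<^sup>2 * l - 2 * m * I)"
    using assms(1) by (simp add: zero_le_mult_iff)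
  also have "\<dots> = l * (LINT x|?M. (w x)\<^sup>2) - I\<^sup>2"
    using assms(1) by (simp add: m_def field_simps power2_eq_square)
  finally show ?thesis by (simp add: I_def)
qed

lemma abs_integral_Icc_le:
  fixes w :: "real \<Rightarrow> real"
  assumes "integrable (lebesgue_on {0..l}) w" "x \<in> {0..l}"
  shows "\<bar>integral {0..x} w\<bar> \<le> (LINT x|lebesgue_on {0..l}. \<bar>w x\<bar>)"
proof -
  have i: "w integrable_on {0..l}" "(\<lambda>x. \<bar>w x\<bar>) integrable_on {0..l}"
    using assms(1) by (auto intro!: integrable_on_lebesgue_on)
  have j: "w integrable_on {0..x}" "(\<lambda>x. \<bar>w x\<bar>) integrable_on {0..x}"
    using i assms(2) by (auto elim!: integrable_subinterval_real)
  have "\<bar>integral {0..x} w\<bar> \<le> integral {0..x} (\<lambda>x. \<bar>w x\<bar>)"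
    using integral_norm_bound_integral[OF j] by simp
  also have "\<dots> \<le> integral {0..l} (\<lambda>x. \<bar>w x\<bar>)"
    using assms(2) by (intro integral_subset_le i j) auto
  also have "\<dots> = (LINT x|lebesgue_on {0..l}. \<bar>w x\<bar>)"
    using assms(1) by (simp add: lebesgue_integral_eq_integral)
  finally show ?thesis .
qed

text \<open>Since \<open>g\<close> is merely integrable, the classical product rule is replaced by
  Fubini for \<open>g y * D x\<close> on the triangle y \<le> x: integrating over y first produces
  the indefinite integral, integrating over x first produces \<open>\<phi> l - \<phi> y\<close>,
  where the first term vanishes.\<close>

lemma indefinite_integral_by_parts:
  fixes g \<phi> D :: "real \<Rightarrow> real"
  assumes g: "integrable (lebesgue_on {0..l}) g"
    and \<phi>: "\<And>x. (\<phi> has_vector_derivative D x) (at x)" and D: "continuous_on UNIV D"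
    and "\<phi> l = 0"
  shows "(LINT x|lebesgue_on {0..l}. integral {0..x} g * D x)
       = - (LINT x|lebesgue_on {0..l}. g x * \<phi> x)"
proof -
  let ?M = "lebesgue_on {0..l}"
  interpret finite_measure ?M by (rule finite_measure_lebesgue_on) simp
  interpret pair_sigma_finite ?M ?M ..
  have Dm [measurable]: "D \<in> borel_measurable ?M"
    using D by (auto intro!: continuous_imp_measurable_on_sets_lebesgue elim: continuous_on_subset)
  have gm [measurable]: "g \<in> borel_measurable ?M" using g by simp
  have idm [measurable]: "(\<lambda>x. x) \<in> borel_measurable ?M"
    by (auto intro!: continuous_imp_measurable_on_sets_lebesgue)
  have Di: "integrable ?M D"
    using D by (auto intro!: continuous_imp_integrable_real elim: continuous_on_subset)
  define k where "k = (\<lambda>x y. if y \<le> x then g y * D x else 0)"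
  have [measurable]: "case_prod k \<in> borel_measurable (?M \<Otimes>\<^sub>M ?M)"
    unfolding k_def by measurable
  have k: "integrable (?M \<Otimes>\<^sub>M ?M) (case_prod k)"
  proof (rule Bochner_Integration.integrable_bound)
    show "integrable (?M \<Otimes>\<^sub>M ?M) (\<lambda>(x, y). g y * D x)"
    proof (rule Fubini_integrable)
      show "integrable ?M (\<lambda>x. LINT y|?M. norm (case (x, y) of (x, y) \<Rightarrow> g y * D x))"
        using g Di by (simp add: abs_mult)
    qed (use g in auto)
    show "AE z in ?M \<Otimes>\<^sub>M ?M. norm (case z of (x, y) \<Rightarrow> k x y) \<le> norm (case z of (x, y) \<Rightarrow> g y * D x)"
      by (auto simp: k_def)
  qed simp
  have 1: "(LINT y|?M. k x y) = integral {0..x} g * D x" if "x \<in> {0..l}" for x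
  proof -
    have "(LINT y|?M. k x y) = (LINT y|?M. (if y \<in> {..x} then g y * D x else 0))"
      by (simp add: k_def)
    also have "\<dots> = (LINT y|lebesgue_on ({..x} \<inter> {0..l}). g y * D x)"
      by (intro Lebesgue_Measure.integral_restrict_Int) auto
    also have "{..x} \<inter> {0..l} = {0..x}" using that by auto
    also have "(LINT y|lebesgue_on {0..x}. g y * D x) = integral {0..x} g * D x"
      using Equivalence_Lebesgue_Henstock_Integration.integrable_subinterval[OF g, of 0 x] that by (simp add: lebesgue_integral_eq_integral)
    finally show ?thesis .
  qed
  have 2: "(LINT x|?M. k x y) = - (g y * \<phi> y)" if "y \<in> {0..l}" for y
  proof -
    have "(LINT x|?M. k x y) = (LINT x|?M. (if x \<in> {y..} then g y * D x else 0))"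
      by (simp add: k_def)
    also have "\<dots> = (LINT x|lebesgue_on ({y..} \<inter> {0..l}). g y * D x)"
      by (intro Lebesgue_Measure.integral_restrict_Int) auto
    also have "{y..} \<inter> {0..l} = {y..l}" using that by auto
    also have "(LINT x|lebesgue_on {y..l}. g y * D x) = g y * integral {y..l} D"
      using Equivalence_Lebesgue_Henstock_Integration.integrable_subinterval[OF Di, of y l] that by (simp add: lebesgue_integral_eq_integral)
    also have "(D has_integral (\<phi> l - \<phi> y)) {y..l}"
      using that \<phi> by (intro fundamental_theorem_of_calculus) (auto intro: has_vector_derivative_at_within)
    then have "integral {y..l} D = \<phi> l - \<phi> y" by (rule integral_unique)
    finally show ?thesis using \<open>\<phi> l = 0\<close> by simp
  qed
  have "(LINT x|?M. integral {0..x} g * D x) = (LINT x|?M. LINT y|?M. k x y)"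
    by (intro Bochner_Integration.integral_cong) (auto simp: 1)
  also have "\<dots> = (LINT y|?M. LINT x|?M. k x y)"
    using Fubini_integral[OF k] by simp
  also have "\<dots> = (LINT y|?M. - (g y * \<phi> y))"
    by (intro Bochner_Integration.integral_cong) (auto simp: 2)
  finally show ?thesis by simp
qed

subsection \<open>The lemma of du Bois-Reymond\<close>

lemma continuous_imp_antiderivative:
  fixes f :: "real \<Rightarrow> real"
  assumes "continuous_on UNIV f"
  obtains F where "\<And>x. (F has_vector_derivative f x) (at x)"
  using einterval_antiderivative[of "-\<infinity>" "\<infinity>" f] assms
  by (auto simp: continuous_on_eq_continuous_at)

text \<open>
  Differences of two translated trapezoids of height 1 are derivatives of test functions.  As
  \<open>n\<close> grows they become differences of indicators, so a function orthogonal to all derivatives of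
  test functions has the same mean over all intervals of a given length, hence the same value at
  all its Lebesgue points.
\<close>

definition trapezoid :: "nat \<Rightarrow> real \<Rightarrow> real \<Rightarrow> real" where
  "trapezoid n \<epsilon> y = max 0 (min 1 (min (n * y) (n * (\<epsilon> - y))))"

lemma continuous_on_trapezoid: "continuous_on A (\<lambda>x. trapezoid n \<epsilon> (x - s))"
  unfolding trapezoid_def by (intro continuous_intros)

lemma trapezoid_eq_0: "y \<le> 0 \<or> \<epsilon> \<le> y \<Longrightarrow> trapezoid n \<epsilon> y = 0"
proof -
  assume "y \<le> 0 \<or> \<epsilon> \<le> y"
  then have "n * y \<le> 0 \<or> n * (\<epsilon> - y) \<le> 0"
    by (auto intro: mult_nonneg_nonpos)
  then show ?thesis
    by (auto simp: trapezoid_def)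
qed

lemma trapezoid_tendsto_indicator:
  "(\<lambda>n. trapezoid n \<epsilon> y) \<longlonglongrightarrow> indicator {0<..<\<epsilon>} y"
proof (cases "y \<in> {0<..<\<epsilon>}")
  case True
  have "\<forall>\<^sub>F n in sequentially. 1 / y \<le> real n" "\<forall>\<^sub>F n in sequentially. 1 / (\<epsilon> - y) \<le> real n"
    using filterlim_real_sequentially unfolding filterlim_at_top by blast+
  then have "\<forall>\<^sub>F n in sequentially. trapezoid n \<epsilon> y = 1"
    by eventually_elim (use True in \<open>auto simp: trapezoid_def field_simps min_def\<close>)
  then show ?thesis
    using True by (auto intro: tendsto_eventually)
next
  case False
  then show ?thesis using trapezoid_eq_0[of y \<epsilon>] by (simp add: not_less)
qed

text \<open>Dominated convergence with majorant \<open>\<bar>h x\<bar>\<close>, as trapezoids lie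
  between 0 and 1. The limit is the indicator of an open interval, whose missing endpoints do not
  affect the integral.\<close>

lemma trapezoid_integral_tendsto:
  assumes h: "integrable (lebesgue_on {0..l}) h" and s: "0 \<le> s" "s + \<epsilon> \<le> l"
  shows "(\<lambda>n. LINT x|lebesgue_on {0..l}. h x * trapezoid n \<epsilon> (x - s)) \<longlonglongrightarrow> integral {s..s+\<epsilon>} h"
proof -
  let ?M = "lebesgue_on {0..l}"
  have [measurable]: "h \<in> borel_measurable ?M" using h by simp
  have [measurable]: "(\<lambda>x. trapezoid n \<epsilon> (x - s)) \<in> borel_measurable ?M" for n
    by (intro continuous_imp_measurable_on_sets_lebesgue continuous_on_trapezoid) auto
  have [measurable]: "(\<lambda>x. indicat_real {0<..<\<epsilon>} (x - s)) \<in> borel_measurable ?M"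
    by (rule borel_measurable_LIMSEQ_metric[OF _ trapezoid_tendsto_indicator]) simp
  have "(\<lambda>n. LINT x|?M. h x * trapezoid n \<epsilon> (x - s)) \<longlonglongrightarrow> (LINT x|?M. h x * indicator {0<..<\<epsilon>} (x - s))"
  proof (rule integral_dominated_convergence)
    show "integrable ?M (\<lambda>x. \<bar>h x\<bar>)" using h by simp
    show "AE x in ?M. (\<lambda>n. h x * trapezoid n \<epsilon> (x - s)) \<longlonglongrightarrow> h x * indicator {0<..<\<epsilon>} (x - s)"
      by (intro AE_I2 tendsto_mult_left trapezoid_tendsto_indicator)
    have "\<bar>trapezoid n \<epsilon> y\<bar> \<le> 1" for n y by (auto simp: trapezoid_def)
    then show "AE x in ?M. norm (h x * trapezoid n \<epsilon> (x - s)) \<le> \<bar>h x\<bar>" for n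
      by (auto simp: abs_mult mult_left_le)
  qed measurable
  also have "(LINT x|?M. h x * indicator {0<..<\<epsilon>} (x - s)) = integral {0..l} (\<lambda>x. h x * indicator {0<..<\<epsilon>} (x - s))"
  proof (intro lebesgue_integral_eq_integral Bochner_Integration.integrable_bound[OF h])
    show "AE x in ?M. norm (h x * indicator {0<..<\<epsilon>} (x - s)) \<le> norm (h x)"
      by (rule AE_I2) (simp split: split_indicator)
  qed simp_all
  also have "\<dots> = integral {0..l} (\<lambda>x. if x \<in> {s<..<s+\<epsilon>} then h x else 0)"
    by (intro integral_cong) (auto simp: indicator_def)
  also have "\<dots> = integral ({s<..<s+\<epsilon>} \<inter> {0..l}) h"
    by (rule Henstock_Kurzweil_Integration.integral_restrict_Int)
  also have "{s<..<s+\<epsilon>} \<inter> {0..l} = {s<..<s+\<epsilon>}" using s by auto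
  also have "integral {s<..<s+\<epsilon>} h = integral {s..s+\<epsilon>} h"
    by (simp add: integral_open_interval_real)
  finally show ?thesis .
qed

text \<open>The antiderivative of one bump is constant on each side of it but with different
  constants. Subtracting a translate makes both constants cancel, so the support lies in
  \<open>{s..t+\<epsilon>}\<close>, a compact part of the open interval.\<close>

lemma test_function_trapezoid_difference:
  assumes "0 < s" "s < t" "t + \<epsilon> < l"
  obtains \<phi> where "test_function l \<phi>"
    "\<And>x. deriv \<phi> x = trapezoid n \<epsilon> (x - s) - trapezoid n \<epsilon> (x - t)"
proof -
  have "continuous_on UNIV (trapezoid n \<epsilon>)"
    using continuous_on_trapezoid[of UNIV n \<epsilon> 0] by simp
  then obtain F where F: "\<And>x. (F has_vector_derivative trapezoid n \<epsilon> x) (at x)"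
    using continuous_imp_antiderivative by blast
  have F': "(F has_real_derivative trapezoid n \<epsilon> x) (at x)" for x
    using F by (simp add: has_real_derivative_iff_has_vector_derivative)
  define \<phi> where "\<phi> = (\<lambda>x. F (x - s) - F (x - t))"
  have \<phi>: "(\<phi> has_real_derivative trapezoid n \<epsilon> (x - s) - trapezoid n \<epsilon> (x - t)) (at x)" for x
    unfolding \<phi>_def
    by (rule derivative_eq_intros DERIV_chain'[OF _ F'] refl | simp)+
  have \<phi>': "(\<phi> has_vector_derivative trapezoid n \<epsilon> (x - s) - trapezoid n \<epsilon> (x - t)) (at x)" for x
    using \<phi> by (simp add: has_real_derivative_iff_has_vector_derivative)
  have left: "F y = F 0" if "y \<le> 0" for y
  proof -
    have "(F has_real_derivative 0) (at x within {..0})" if "x \<in> {..0}" for x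
      using F'[of x] that by (auto simp: trapezoid_eq_0 intro: DERIV_subset)
    then obtain c where "\<forall>x\<in>{..0}. F x = c"
      using has_field_derivative_zero_constant[of "{..0::real}" F] by auto
    then show ?thesis using that by auto
  qed
  have right: "F y = F \<epsilon>" if "\<epsilon> \<le> y" for y
  proof -
    have "(F has_real_derivative 0) (at x within {\<epsilon>..})" if "x \<in> {\<epsilon>..}" for x
      using F'[of x] that by (auto simp: trapezoid_eq_0 intro: DERIV_subset)
    then obtain c where "\<forall>x\<in>{\<epsilon>..}. F x = c"
      using has_field_derivative_zero_constant[of "{\<epsilon>..}" F] by auto
    then show ?thesis using that by auto
  qed
  have "{x. \<phi> x \<noteq> 0} \<subseteq> {s..t+\<epsilon>}"
  proof (intro subsetI, rule ccontr)
    fix x assume "x \<in> {x. \<phi> x \<noteq> 0}" "x \<notin> {s..t+\<epsilon>}"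
    then show False
      using assms(2) left[of "x - s"] left[of "x - t"] right[of "x - s"] right[of "x - t"]
      by (auto simp: \<phi>_def not_le)
  qed
  then have "closure {x. \<phi> x \<noteq> 0} \<subseteq> {s..t+\<epsilon>}"
    by (intro closure_minimal) auto
  moreover have "\<phi> C1_differentiable_on UNIV"
    unfolding C1_differentiable_on_def
    by (intro exI[of _ "\<lambda>x. trapezoid n \<epsilon> (x - s) - trapezoid n \<epsilon> (x - t)"] conjI ballI \<phi>'
        continuous_on_diff continuous_on_trapezoid)
  ultimately have "test_function l \<phi>"
    using assms by (auto simp: test_function_def)
  then show ?thesis
    using that \<phi> DERIV_imp_deriv by blast
qed

text \<open>Lebesgue's differentiation theorem with one-sided windows; these are the shape of the
  intervals on which the trapezoids concentrate.\<close>

lemma Lebesgue_points_Icc: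
  fixes h :: "real \<Rightarrow> real"
  assumes h: "h integrable_on {0..l}"
  obtains N where "negligible N"
    "\<And>x. x \<in> {0<..<l} \<Longrightarrow> x \<notin> N \<Longrightarrow> ((\<lambda>\<epsilon>. integral {x..x+\<epsilon>} h / \<epsilon>) \<longlongrightarrow> h x) (at_right 0)"
proof -
  \<comment> \<open>Extension by zero gives a function integrable on every bounded interval of the
    line. Windows starting at an interior x and shorter than \<open>l - x\<close> do not see the
    extension.\<close>
  define k where "k = (\<lambda>x. if x \<in> {0..l} then h x else 0)"
  have "k integrable_on cbox a b" for a b :: real
  proof -
    have "k integrable_on UNIV" using h unfolding k_def integrable_restrict_UNIV .
    then show ?thesis using integrable_on_subcbox by blast
  qed
  then obtain N where N: "negligible N" and lim: "\<And>x e. \<lbrakk>x \<notin> N; 0 < e\<rbrakk> \<Longrightarrow>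
      \<exists>d>0. \<forall>r. 0 < r \<and> r < d \<longrightarrow> norm (integral (cbox x (x + r *\<^sub>R One)) k /\<^sub>R r ^ DIM(real) - k x) < e"
    using integrable_ccontinuous_explicit by blast
  show thesis
  proof (rule that[OF N])
    fix x assume x: "x \<in> {0<..<l}" "x \<notin> N"
    have "((\<lambda>\<epsilon>. integral {x..x+\<epsilon>} k / \<epsilon>) \<longlongrightarrow> k x) (at_right 0)"
      unfolding tendsto_iff dist_real_def eventually_at_right_field
      using lim[OF x(2)] by (fastforce simp: divide_inverse_commute)
    moreover have "\<forall>\<^sub>F \<epsilon> in at_right 0. integral {x..x+\<epsilon>} k / \<epsilon> = integral {x..x+\<epsilon>} h / \<epsilon>"
      using x(1) unfolding eventually_at_right_field
      by (intro exI[of _ "l - x"])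
         (auto simp: k_def intro!: integral_cong arg_cong2[of _ _ _ _ divide])
    ultimately have "((\<lambda>\<epsilon>. integral {x..x+\<epsilon>} h / \<epsilon>) \<longlongrightarrow> k x) (at_right 0)"
      by (rule Lim_transform_eventually)
    moreover have "k x = h x" using x(1) by (simp add: k_def)
    ultimately show "((\<lambda>\<epsilon>. integral {x..x+\<epsilon>} h / \<epsilon>) \<longlongrightarrow> h x) (at_right 0)"
      by simp
  qed
qed

lemma du_Bois_Reymond:
  assumes h: "integrable (lebesgue_on {0..l}) h"
    and zero: "\<And>\<phi>. test_function l \<phi> \<Longrightarrow> (LINT x|lebesgue_on {0..l}. h x * deriv \<phi> x) = 0"
  obtains c where "AE x in lebesgue_on {0..l}. h x = c"
proof -
  have eq: "integral {s..s+\<epsilon>} h = integral {t..t+\<epsilon>} h" if "0 < s" "s < t" "0 < \<epsilon>" "t + \<epsilon> < l" for s t \<epsilon>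
  proof -
    have "(LINT x|lebesgue_on {0..l}. h x * trapezoid n \<epsilon> (x - s)) =
      (LINT x|lebesgue_on {0..l}. h x * trapezoid n \<epsilon> (x - t))" for n
    proof -
      obtain \<phi> where \<phi>: "test_function l \<phi>"
        "\<And>x. deriv \<phi> x = trapezoid n \<epsilon> (x - s) - trapezoid n \<epsilon> (x - t)"
        using test_function_trapezoid_difference[of s t \<epsilon> l n] \<open>0 < s\<close> \<open>s < t\<close> \<open>t + \<epsilon> < l\<close> by metis
      have i: "integrable (lebesgue_on {0..l}) (\<lambda>x. h x * trapezoid n \<epsilon> (x - r))" for r
      proof (rule Bochner_Integration.integrable_bound[OF h])
        show "(\<lambda>x. h x * trapezoid n \<epsilon> (x - r)) \<in> borel_measurable (lebesgue_on {0..l})"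
          by (intro borel_measurable_times borel_measurable_integrable[OF h]
              continuous_imp_measurable_on_sets_lebesgue continuous_on_trapezoid) auto
        have "\<bar>trapezoid n \<epsilon> y\<bar> \<le> 1" for y by (auto simp: trapezoid_def)
        then show "AE x in lebesgue_on {0..l}. norm (h x * trapezoid n \<epsilon> (x - r)) \<le> norm (h x)"
          by (auto simp: abs_mult mult_left_le)
      qed
      show ?thesis
        using zero[OF \<phi>(1)] i by (simp add: \<phi>(2) right_diff_distrib)
    qed
    then have "(\<lambda>n. LINT x|lebesgue_on {0..l}. h x * trapezoid n \<epsilon> (x - t)) \<longlonglongrightarrow> integral {s..s+\<epsilon>} h"
      using trapezoid_integral_tendsto[OF h, of s \<epsilon>] that by simp
    moreover have "(\<lambda>n. LINT x|lebesgue_on {0..l}. h x * trapezoid n \<epsilon> (x - t)) \<longlonglongrightarrow> integral {t..t+\<epsilon>} h"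
      using that by (intro trapezoid_integral_tendsto[OF h]) auto
    ultimately show ?thesis by (rule LIMSEQ_unique)
  qed
  have "h integrable_on {0..l}" using h by (simp add: integrable_on_lebesgue_on)
  then obtain N where N: "negligible N" and lim:
    "\<And>x. x \<in> {0<..<l} \<Longrightarrow> x \<notin> N \<Longrightarrow> ((\<lambda>\<epsilon>. integral {x..x+\<epsilon>} h / \<epsilon>) \<longlongrightarrow> h x) (at_right 0)"
    using Lebesgue_points_Icc by blast
  have const: "h s = h t" if "s \<in> {0<..<l} - N" "t \<in> {0<..<l} - N" "s < t" for s t
  proof -
    have "((\<lambda>\<epsilon>. integral {s..s+\<epsilon>} h / \<epsilon>) \<longlongrightarrow> h s) (at_right 0)"
      using lim[of s] that by blast
    moreover have "\<forall>\<^sub>F \<epsilon> in at_right 0. integral {s..s+\<epsilon>} h / \<epsilon> = integral {t..t+\<epsilon>} h / \<epsilon>"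
      unfolding eventually_at_right_field
    \<comment> \<open>Below this width the window at t stays inside the interval, and the window at
      s < t stays inside as well.\<close>
    proof (intro exI[of _ "l - t"] conjI allI impI)
      show "0 < l - t" using that by simp
      fix \<epsilon> :: real assume "0 < \<epsilon>" "\<epsilon> < l - t"
      then show "integral {s..s+\<epsilon>} h / \<epsilon> = integral {t..t+\<epsilon>} h / \<epsilon>"
        using that eq[of s t \<epsilon>] by simp
    qed
    ultimately have "((\<lambda>\<epsilon>. integral {t..t+\<epsilon>} h / \<epsilon>) \<longlongrightarrow> h s) (at_right 0)"
      by (rule Lim_transform_eventually)
    then show ?thesis
      using tendsto_unique[of "at_right (0::real)"] lim[of t] that by auto
  qed
  have "h s = h t" if "s \<in> {0<..<l} - N" "t \<in> {0<..<l} - N" for s t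
    using const[of s t] const[of t s] that by (cases s t rule: linorder_cases) auto
  \<comment> \<open>The constant is the value at an arbitrary reference point. If no such point
    exists, for instance for l \<le> 0, the claim is vacuous.\<close>
  then have "h x = h (SOME s. s \<in> {0<..<l} - N)" if "x \<in> {0<..<l} - N" for x
    using that someI_ex[of "\<lambda>s. s \<in> {0<..<l} - N"] by blast
  then show thesis
    by (intro that AE_lebesgue_on_negligibleI[OF N]) auto
qed

text \<open>All window integrals vanish as differences of indefinite integrals, hence so does the
  value at each Lebesgue point. This is the last step in the uniqueness of weak derivatives.\<close>

lemma AE_eq_0_if_indefinite_integral_0:
  fixes h :: "real \<Rightarrow> real"
  assumes h: "h integrable_on {0..l}" and zero: "\<And>x. x \<in> {0..l} \<Longrightarrow> integral {0..x} h = 0"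
  shows "AE x in lebesgue_on {0..l}. h x = 0"
proof -
  obtain N where N: "negligible N" and lim:
    "\<And>x. x \<in> {0<..<l} \<Longrightarrow> x \<notin> N \<Longrightarrow> ((\<lambda>\<epsilon>. integral {x..x+\<epsilon>} h / \<epsilon>) \<longlongrightarrow> h x) (at_right 0)"
    using Lebesgue_points_Icc[OF h] by blast
  show ?thesis
  proof (rule AE_lebesgue_on_negligibleI[OF N])
    fix x assume x: "x \<in> {0<..<l}" "x \<notin> N"
    have "integral {x..x+\<epsilon>} h = 0" if "0 < \<epsilon>" "\<epsilon> < l - x" for \<epsilon>
    proof -
      have "h integrable_on {0..x+\<epsilon>}"
        using h that x by (auto elim!: integrable_subinterval_real)
      then have "integral {0..x} h + integral {x..x+\<epsilon>} h = integral {0..x+\<epsilon>} h"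
        using that x by (intro Henstock_Kurzweil_Integration.integral_combine) auto
      then show ?thesis using zero[of x] zero[of "x + \<epsilon>"] that x by auto
    qed
    then have "\<forall>\<^sub>F \<epsilon> in at_right 0. integral {x..x+\<epsilon>} h / \<epsilon> = 0"
      unfolding eventually_at_right_field using x by (intro exI[of _ "l - x"]) auto
    then have "((\<lambda>\<epsilon>. 0) \<longlongrightarrow> h x) (at_right (0::real))"
      using lim[OF x] by (rule Lim_transform_eventually[rotated])
    then show "h x = 0"
      using tendsto_unique[of "at_right (0::real)" "\<lambda>_. 0::real"] by auto
  qed
qed

subsection \<open>Weak derivatives and traces on an interval\<close>

lemma test_functionD:
  assumes "test_function l \<phi>"
  shows "(\<phi> has_vector_derivative deriv \<phi> x) (at x)" "continuous_on UNIV (deriv \<phi>)"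
    "\<phi> 0 = 0" "\<phi> l = 0"
proof -
  obtain D where D: "\<And>x. (\<phi> has_vector_derivative D x) (at x)" "continuous_on UNIV D"
    using assms by (auto simp: test_function_def C1_differentiable_on_def)
  have "deriv \<phi> = D"
    using D(1) by (auto simp: has_real_derivative_iff_has_vector_derivative intro!: DERIV_imp_deriv)
  then show "(\<phi> has_vector_derivative deriv \<phi> x) (at x)" "continuous_on UNIV (deriv \<phi>)"
    using D by auto
  show "\<phi> 0 = 0" "\<phi> l = 0"
    using assms closure_subset[of "{x. \<phi> x \<noteq> 0}"] by (force simp: test_function_def)+
qed

lemma test_function_L2:
  assumes "test_function l \<phi>"
  shows "\<phi> \<in> L2_interval l" "deriv \<phi> \<in> L2_interval l"
proof -
  have "continuous_on {0..l} \<phi>"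
    using test_functionD(1)[OF assms]
    by (intro continuous_at_imp_continuous_on) (auto intro: has_vector_derivative_continuous)
  moreover have "continuous_on {0..l} (deriv \<phi>)"
    using test_functionD(2)[OF assms] by (rule continuous_on_subset) simp
  ultimately show "\<phi> \<in> L2_interval l" "deriv \<phi> \<in> L2_interval l"
    by (auto intro: L2_interval_continuous)
qed

text \<open>For \<open>g\<close> in \<open>L2_interval l\<close> these are, up to null sets, exactly
  the members of \<open>H1_interval l\<close>: \<open>c\<close> is the trace at the tail and
  \<open>g\<close> the weak derivative.\<close>

definition primitive :: "real \<Rightarrow> (real \<Rightarrow> real) \<Rightarrow> real \<Rightarrow> real" where
  "primitive c g x = c + integral {0..x} g"

lemma primitive_0 [simp]: "primitive c g 0 = c"
  by (simp add: primitive_def)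

lemma continuous_on_primitive:
  assumes "g \<in> L2_interval l"
  shows "continuous_on {0..l} (primitive c g)"
  unfolding primitive_def
  by (intro continuous_intros indefinite_integral_continuous_1 integrable_on_lebesgue_on
      L2_interval_integrable assms) auto

lemma primitive_L2: "g \<in> L2_interval l \<Longrightarrow> primitive c g \<in> L2_interval l"
  by (rule L2_interval_continuous[OF continuous_on_primitive])

lemma has_weak_deriv_primitive:
  assumes g: "g \<in> L2_interval l"
  shows "has_weak_deriv l (primitive c g) g"
  unfolding has_weak_deriv_def
proof (intro allI impI)
  fix \<phi> assume \<phi>: "test_function l \<phi>"
  let ?M = "lebesgue_on {0..l}"
  have parts: "(LINT x|?M. integral {0..x} h * deriv \<phi> x) = - (LINT x|?M. h x * \<phi> x)"
    if "h \<in> L2_interval l" for h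
    using test_functionD[OF \<phi>] that
    by (intro indefinite_integral_by_parts L2_interval_integrable) auto
  have i: "integrable ?M (\<lambda>x. primitive 0 g x * deriv \<phi> x)" "integrable ?M (deriv \<phi>)"
    using test_function_L2[OF \<phi>] g
    by (auto intro: integrable_mult_L2_interval primitive_L2 L2_interval_integrable)
  \<comment> \<open>The constant \<open>c\<close> contributes \<open>c\<close> times this integral,
    which is zero because a test function vanishes at both ends.\<close>
  have "(LINT x|?M. deriv \<phi> x) = 0"
  proof (cases "0 \<le> l")
    case True
    have "(deriv \<phi> has_integral \<phi> l - \<phi> 0) {0..l}"
      using True test_functionD(1)[OF \<phi>]
      by (intro fundamental_theorem_of_calculus) (auto intro: has_vector_derivative_at_within)
    then show ?thesis
      using i(2) test_functionD(3,4)[OF \<phi>] by (simp add: lebesgue_integral_eq_integral integral_unique)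
  qed simp
  then have "(LINT x|?M. primitive c g x * deriv \<phi> x) = (LINT x|?M. primitive 0 g x * deriv \<phi> x)"
    using Bochner_Integration.integral_add[OF integrable_mult_right[OF i(2), of c] i(1)]
    by (simp add: primitive_def algebra_simps)
  also have "\<dots> = - (LINT x|?M. g x * \<phi> x)"
    using parts[OF g] by (simp add: primitive_def)
  finally show "(LINT x|?M. primitive c g x * deriv \<phi> x) = - (LINT x|?M. g x * \<phi> x)" .
qed

lemma primitive_H1: "g \<in> L2_interval l \<Longrightarrow> primitive c g \<in> H1_interval l"
  using primitive_L2[of g l c] has_weak_deriv_primitive[of g l c] by (auto simp: H1_interval_def)

lemma has_weak_deriv_diff:
  assumes "v \<in> L2_interval l" "g \<in> L2_interval l" "w \<in> L2_interval l" "h \<in> L2_interval l"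
    and "has_weak_deriv l v g" "has_weak_deriv l w h"
  shows "has_weak_deriv l (\<lambda>x. v x - w x) (\<lambda>x. g x - h x)"
  unfolding has_weak_deriv_def
proof (intro allI impI)
  fix \<phi> assume \<phi>: "test_function l \<phi>"
  show "(LINT x|lebesgue_on {0..l}. (v x - w x) * deriv \<phi> x) = - (LINT x|lebesgue_on {0..l}. (g x - h x) * \<phi> x)"
    using assms(5,6) \<phi> test_function_L2[OF \<phi>] integrable_mult_L2_interval assms(1-4)
    by (simp add: left_diff_distrib has_weak_deriv_def)
qed

lemma has_weak_deriv_0_imp_constant:
  assumes w: "w \<in> L2_interval l" and "has_weak_deriv l w (\<lambda>_. 0)"
  obtains c where "AE x in lebesgue_on {0..l}. w x = c"
  using assms by (auto simp: has_weak_deriv_def intro: du_Bois_Reymond L2_interval_integrable)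

text \<open>Subtracting a primitive of \<open>g\<close> leaves a function with weak derivative zero,
  which is constant by du Bois-Reymond.\<close>

lemma has_weak_deriv_imp_primitive:
  assumes w: "w \<in> L2_interval l" and g: "g \<in> L2_interval l" and "has_weak_deriv l w g"
  obtains c where "AE x in lebesgue_on {0..l}. primitive c g x = w x"
proof -
  have "has_weak_deriv l (\<lambda>x. w x - primitive 0 g x) (\<lambda>x. g x - g x)"
    by (intro has_weak_deriv_diff assms primitive_L2 has_weak_deriv_primitive)
  then obtain c where "AE x in lebesgue_on {0..l}. w x - primitive 0 g x = c"
    using has_weak_deriv_0_imp_constant[OF L2_interval_diff[OF w primitive_L2[OF g]]] by auto
  then have "AE x in lebesgue_on {0..l}. primitive c g x = w x"
    by eventually_elim (auto simp: primitive_def)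
  then show ?thesis by (rule that)
qed

text \<open>The difference of two weak derivatives is a weak derivative of zero. Its primitive is
  therefore zero almost everywhere, by continuity everywhere, so its indefinite integral vanishes.
  No density of test functions is involved.\<close>

lemma has_weak_deriv_unique:
  assumes "0 < l" and w: "w \<in> L2_interval l" and g: "g \<in> L2_interval l" "h \<in> L2_interval l"
    and "has_weak_deriv l w g" "has_weak_deriv l w h"
  shows "AE x in lebesgue_on {0..l}. g x = h x"
proof -
  let ?k = "\<lambda>x. g x - h x"
  have k: "?k \<in> L2_interval l" by (intro L2_interval_diff g)
  have "has_weak_deriv l (\<lambda>x. w x - w x) ?k"
    by (intro has_weak_deriv_diff assms)
  then obtain c where c: "AE x in lebesgue_on {0..l}. primitive c ?k x = 0"
    using has_weak_deriv_imp_primitive[OF _ k, of "\<lambda>_. 0"] L2_interval_continuous[of l "\<lambda>_. 0"] by auto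
  have *: "primitive c ?k x = 0" if "x \<in> {0..l}" for x
    using continuous_AE_eq_imp_eq[OF \<open>0 < l\<close> continuous_on_primitive[OF k] _ c that] by simp
  have "integral {0..x} ?k = 0" if "x \<in> {0..l}" for x
    using *[of 0] *[OF that] \<open>0 < l\<close> by (simp add: primitive_def)
  then have "AE x in lebesgue_on {0..l}. ?k x = 0"
    using k by (intro AE_eq_0_if_indefinite_integral_0 integrable_on_lebesgue_on L2_interval_integrable) auto
  then show ?thesis by simp
qed

lemma weak_deriv_L2:
  assumes "w \<in> H1_interval l"
  shows "weak_deriv l w \<in> L2_interval l" and "has_weak_deriv l w (weak_deriv l w)"
proof -
  have "\<exists>g. g \<in> L2_interval l \<and> has_weak_deriv l w g"
    using assms by (auto simp: H1_interval_def)
  from someI_ex[OF this] show "weak_deriv l w \<in> L2_interval l" "has_weak_deriv l w (weak_deriv l w)"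
    unfolding weak_deriv_def by auto
qed

lemma weak_deriv_primitive:
  assumes "0 < l" "g \<in> L2_interval l"
  shows "AE x in lebesgue_on {0..l}. weak_deriv l (primitive c g) x = g x"
  using has_weak_deriv_unique[OF assms(1) primitive_L2[OF assms(2)]
      weak_deriv_L2(1)[OF primitive_H1[OF assms(2)]] assms(2)
      weak_deriv_L2(2)[OF primitive_H1[OF assms(2)]] has_weak_deriv_primitive[OF assms(2)]] .

text \<open>Two continuous representatives agree at every point, so the \<open>THE\<close> in the
  trace is resolved by whichever one is at hand.\<close>

lemma interval_trace_eq:
  assumes "0 < l" "continuous_on {0..l} v" "AE y in lebesgue_on {0..l}. v y = w y" "x \<in> {0..l}"
  shows "interval_trace l w x = v x"
  unfolding interval_trace_def
proof (rule the_equality)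
  show "\<exists>w'. continuous_on {0..l} w' \<and> (AE y in lebesgue_on {0..l}. w' y = w y) \<and> w' x = v x"
    using assms by blast
next
  fix t assume "\<exists>w'. continuous_on {0..l} w' \<and> (AE y in lebesgue_on {0..l}. w' y = w y) \<and> w' x = t"
  then obtain w' where w': "continuous_on {0..l} w'" "AE y in lebesgue_on {0..l}. w' y = w y" "w' x = t"
    by blast
  have "AE y in lebesgue_on {0..l}. w' y = v y"
    using w'(2) assms(3) by eventually_elim simp
  then show "t = v x"
    using continuous_AE_eq_imp_eq[OF \<open>0 < l\<close> w'(1) assms(2) _ assms(4)] w'(3) by blast
qed

lemma interval_trace_primitive:
  assumes "0 < l" "g \<in> L2_interval l" "x \<in> {0..l}"
  shows "interval_trace l (primitive c g) x = primitive c g x"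
  using assms by (intro interval_trace_eq continuous_on_primitive) auto

lemma primitive_cong_AE:
  assumes "AE x in lebesgue_on {0..l}. g x = h x" "x \<in> {0..l}"
  shows "primitive c g x = primitive c h x"
proof -
  have "AE y in lebesgue. y \<in> {0..l} \<longrightarrow> g y = h y"
    using assms(1) by (simp only: AE_lebesgue_on_Icc_iff)
  then obtain N where N: "negligible N" "{y. \<not> (y \<in> {0..l} \<longrightarrow> g y = h y)} \<subseteq> N"
    by (auto simp: eventually_ae_filter negligible_iff_null_sets)
  have "integral {0..x} g = integral {0..x} h"
    using N(2) assms(2) by (intro integral_spike[OF N(1)]) auto
  then show ?thesis by (simp add: primitive_def)
qed

text \<open>Stated for any \<open>g\<close> that agrees almost everywhere with the chosen weak
  derivative, so that the differential equations can be inserted directly. The trace formula holds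
  at every point, the head included.\<close>

lemma H1_interval_primitive:
  assumes l: "0 < l" and w: "w \<in> H1_interval l" and g: "g \<in> L2_interval l"
    and eq: "AE x in lebesgue_on {0..l}. weak_deriv l w x = g x"
  shows "AE x in lebesgue_on {0..l}. w x = primitive (interval_trace l w 0) g x"
    and "x \<in> {0..l} \<Longrightarrow> interval_trace l w x = primitive (interval_trace l w 0) g x"
proof -
  have "w \<in> L2_interval l" using w by (simp add: H1_interval_def)
  then obtain c where "AE x in lebesgue_on {0..l}. primitive c (weak_deriv l w) x = w x"
    using has_weak_deriv_imp_primitive weak_deriv_L2[OF w] by blast
  then have c: "AE x in lebesgue_on {0..l}. primitive c g x = w x"
    using AE_space by eventually_elim (use primitive_cong_AE[OF eq] in auto)
  have tr: "interval_trace l w x = primitive c g x" if "x \<in> {0..l}" for x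
    using interval_trace_eq[OF l continuous_on_primitive[OF g] c that] .
  then have [simp]: "interval_trace l w 0 = c" using l by simp
  show "AE x in lebesgue_on {0..l}. w x = primitive (interval_trace l w 0) g x"
    using c by eventually_elim simp
  show "x \<in> {0..l} \<Longrightarrow> interval_trace l w x = primitive (interval_trace l w 0) g x"
    using tr by simp
qed

subsection \<open>The Dirichlet problem for the graph Laplacian\<close>

text \<open>Enumerating \<open>S\<close> turns the system into a square matrix; a trivial kernel
  makes its determinant nonzero. The family \<open>N\<close> is obtained before \<open>b\<close>, so
  solutions depend linearly on \<open>b\<close> with one fixed bound.\<close>

lemma finite_linear_system_right_inverse:
  fixes M :: "'v \<Rightarrow> 'v \<Rightarrow> 'a::field"
  assumes "finite S"
    and kernel: "\<And>x. (\<And>i. i \<in> S \<Longrightarrow> (\<Sum>j\<in>S. M i j * x j) = 0) \<Longrightarrow> \<forall>j\<in>S. x j = 0"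
  obtains N where "\<And>b i. i \<in> S \<Longrightarrow> (\<Sum>j\<in>S. M i j * (\<Sum>k\<in>S. N j k * b k)) = b i"
proof -
  define n where "n = card S"
  obtain h where h: "bij_betw h {0..<n} S"
    using ex_bij_betw_nat_finite[OF \<open>finite S\<close>] by (auto simp: n_def)
  define k where "k = inv_into {0..<n} h"
  have k [simp]: "k (h i) = i" if "i < n" for i
    using h that by (auto simp: k_def bij_betw_def)
  have hS: "h i \<in> S" if "i < n" for i
    using h that by (auto simp: bij_betw_def)
  have sum_S: "(\<Sum>j\<in>S. F j) = (\<Sum>i = 0..<n. F (h i))" for F :: "'v \<Rightarrow> 'a"
    using sum.reindex_bij_betw[OF h, of F] by simp
  have ex_S: "\<exists>p<n. i = h p" if "i \<in> S" for i
    using h that by (auto simp: bij_betw_def)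
  define A where "A = mat n n (\<lambda>(i, j). M (h i) (h j))"
  have A: "A \<in> carrier_mat n n" by (simp add: A_def)
  have "Determinant.det A \<noteq> 0"
  proof
    assume "Determinant.det A = 0"
    then obtain v where v: "v \<in> carrier_vec n" "v \<noteq> 0\<^sub>v n" "A *\<^sub>v v = 0\<^sub>v n"
      using det_0_iff_vec_prod_zero[OF A] by blast
    have "(\<Sum>j\<in>S. M i j * vec_index v (k j)) = 0" if i: "i \<in> S" for i
    proof -
      obtain p where p: "p < n" "i = h p" using ex_S[OF i] by blast
      have "(\<Sum>j\<in>S. M i j * vec_index v (k j)) = vec_index (A *\<^sub>v v) p"
        using p v(1) by (simp add: sum_S A_def scalar_prod_def)
      then show ?thesis using v(3) p(1) by simp
    qed
    then have "\<forall>j\<in>S. vec_index v (k j) = 0" by (rule kernel)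
    then have "vec_index v i = 0" if "i < n" for i
      using hS[OF that] that by force
    then have "v = 0\<^sub>v n" using v(1) by (intro eq_vecI) auto
    then show False using v(2) by simp
  qed
  then have "A \<in> Units (ring_mat TYPE('a) n ())"
    by (rule det_non_zero_imp_unit[OF A])
  then obtain B where B: "B \<in> carrier_mat n n" "A * B = 1\<^sub>m n"
    by (auto simp: Units_def ring_mat_def)
  have "(\<Sum>j\<in>S. M i j * (\<Sum>r\<in>S. B $$ (k j, k r) * b r)) = b i" if i: "i \<in> S" for i b
  proof -
    obtain p where p: "p < n" "i = h p" using ex_S[OF i] by blast
    have AB: "(\<Sum>q = 0..<n. M (h p) (h q) * B $$ (q, r)) = (if p = r then 1 else 0)" if "r < n" for r
    proof -
      have "(\<Sum>q = 0..<n. M (h p) (h q) * B $$ (q, r)) = (A * B) $$ (p, r)"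
        using p that B(1) by (simp add: A_def scalar_prod_def)
      then show ?thesis using p that by (simp add: B(2))
    qed
    have "(\<Sum>j\<in>S. M i j * (\<Sum>r\<in>S. B $$ (k j, k r) * b r))
      = (\<Sum>q = 0..<n. \<Sum>r = 0..<n. M (h p) (h q) * (B $$ (q, r) * b (h r)))"
      by (simp add: sum_S p(2) sum_distrib_left)
    also have "\<dots> = (\<Sum>r = 0..<n. (\<Sum>q = 0..<n. M (h p) (h q) * B $$ (q, r)) * b (h r))"
      by (subst sum.swap) (simp add: sum_distrib_right mult.assoc)
    also have "\<dots> = (\<Sum>r = 0..<n. if p = r then b (h r) else 0)"
      by (intro sum.cong) (auto simp: AB)
    also have "\<dots> = b i" using p by simp
    finally show ?thesis .
  qed
  then show thesis by (rule that[of "\<lambda>j r. B $$ (k j, k r)"])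
qed

section \<open>Incidence matrix, connectedness and the Dirichlet Laplacian\<close>

locale network = pair_digraph G for G :: "'v pair_pre_digraph" +
  fixes len :: "'v \<times> 'v \<Rightarrow> real"
  assumes connected: "Digraph_Component.connected (with_proj G)"
    and boundary: "boundary_vertices G \<noteq> {}"
    and len_pos: "e \<in> parcs G \<Longrightarrow> 0 < len e"
begin

lemma interior_subset: "interior_vertices G \<subseteq> pverts G"
  by (auto simp: interior_vertices_def)

lemma finite_interior: "finite (interior_vertices G)"
  using pair_finite_verts by (simp add: interior_vertices_def)

text \<open>\<open>edge_sign\<close> is the incidence matrix, and its transpose turns vertex values
  into differences along edges. The two end vertices being distinct, they give separate terms.
  Potentials vanishing off \<open>S\<close> allow the sum to be restricted to the interior
  vertices.\<close>

lemma sum_edge_sign: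
  assumes "e \<in> parcs G" "\<And>v. v \<in> pverts G - S \<Longrightarrow> P v = 0" "S \<subseteq> pverts G"
  shows "(\<Sum>v\<in>S. edge_sign e v * P v) = P (snd e) - P (fst e)"
proof -
  have ne: "fst e \<noteq> snd e" and in_verts: "fst e \<in> pverts G" "snd e \<in> pverts G"
    using assms(1) pair_no_loops arc_fst_in_verts arc_snd_in_verts by auto
  have "(\<Sum>v\<in>S. edge_sign e v * P v) = (\<Sum>v\<in>pverts G. edge_sign e v * P v)"
    using assms(2,3) pair_finite_verts by (intro sum.mono_neutral_left) auto
  also have "\<dots> = (\<Sum>v\<in>{fst e, snd e}. edge_sign e v * P v)"
    using in_verts pair_finite_verts by (intro sum.mono_neutral_right) (auto simp: edge_sign_def)
  also have "\<dots> = P (snd e) - P (fst e)"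
    using ne by (simp add: edge_sign_def)
  finally show ?thesis .
qed

text \<open>Connectedness means reachability in the symmetric closure, so the induction runs along
  an undirected path whose steps use an edge in either direction.\<close>

lemma constant_if_edgewise_constant:
  assumes eq: "\<And>e. e \<in> parcs G \<Longrightarrow> P (snd e) = P (fst e)"
    and uv: "u \<in> pverts G" "v \<in> pverts G"
  shows "P u = P v"
proof -
  have "reachable (with_proj (mk_symmetric (with_proj G))) u v"
    using connected uv unfolding Digraph_Component.connected_def strongly_connected_def by auto
  then have "(u, v) \<in> rtrancl_on (pverts G) (parcs (mk_symmetric (with_proj G)))"
    by (simp add: reachable_def)
  then show ?thesis
  proof (induction rule: rtrancl_on_induct)
    case (step x y)
    then have "(x, y) \<in> parcs G \<or> (y, x) \<in> parcs G"
      by (auto simp: parcs_mk_symmetric)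
    then show ?case using eq step.IH by force
  qed simp
qed

text \<open>The energy identity: testing Kirchhoff's law with the potential itself.\<close>

lemma dirichlet_kernel:
  assumes \<kappa>: "\<And>e. e \<in> parcs G \<Longrightarrow> 0 < \<kappa> e"
    and bd: "\<And>v. v \<in> boundary_vertices G \<Longrightarrow> P v = 0"
    and flux: "\<And>v. v \<in> interior_vertices G \<Longrightarrow>
      (\<Sum>e\<in>parcs G. edge_sign e v * (\<kappa> e * (P (snd e) - P (fst e)))) = 0"
    and v: "v \<in> pverts G"
  shows "P v = 0"
proof -
  let ?d = "\<lambda>e. P (snd e) - P (fst e)"
  have "(\<Sum>v\<in>pverts G. P v * (\<Sum>e\<in>parcs G. edge_sign e v * (\<kappa> e * ?d e))) = 0"
    using bd flux by (intro sum.neutral) (auto simp: boundary_vertices_def)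
  also have "(\<Sum>v\<in>pverts G. P v * (\<Sum>e\<in>parcs G. edge_sign e v * (\<kappa> e * ?d e)))
    = (\<Sum>e\<in>parcs G. \<kappa> e * ?d e * (\<Sum>v\<in>pverts G. edge_sign e v * P v))"
    unfolding sum_distrib_left by (subst sum.swap) (simp add: algebra_simps)
  also have "\<dots> = (\<Sum>e\<in>parcs G. \<kappa> e * (?d e)\<^sup>2)"
  proof (rule sum.cong)
    fix e assume e: "e \<in> parcs G"
    have "(\<Sum>v\<in>pverts G. edge_sign e v * P v) = ?d e"
      by (rule sum_edge_sign[OF e]) auto
    then show "\<kappa> e * ?d e * (\<Sum>v\<in>pverts G. edge_sign e v * P v) = \<kappa> e * (?d e)\<^sup>2"
      by (simp only: power2_eq_square mult.assoc)
  qed simp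
  finally have "\<forall>e\<in>parcs G. \<kappa> e * (?d e)\<^sup>2 = 0"
    using pair_finite_arcs \<kappa> by (subst (asm) sum_nonneg_eq_0_iff) (simp_all add: less_imp_le)
  then have "P (snd e) = P (fst e)" if "e \<in> parcs G" for e
  proof -
    have "\<kappa> e * (?d e)\<^sup>2 = 0" "0 < \<kappa> e"
      using \<open>\<forall>e\<in>parcs G. \<kappa> e * (?d e)\<^sup>2 = 0\<close> \<kappa> that by auto
    then show ?thesis by simp
  qed
  \<comment> \<open>The energy argument leaves a constant potential; the value at one boundary
    vertex fixes it as zero.\<close>
  moreover obtain w where "w \<in> boundary_vertices G" using boundary by blast
  ultimately show ?thesis
    using constant_if_edgewise_constant[of P v w] v bd[of w] by (auto simp: boundary_vertices_def)
qed

text \<open>The constant \<open>K\<close> precedes \<open>b\<close> in the quantifiers; this is the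
  source of stability uniform in the data.\<close>

lemma dirichlet_solution:
  assumes \<kappa>: "\<And>e. e \<in> parcs G \<Longrightarrow> 0 < \<kappa> e"
  obtains K where "0 \<le> K"
    "\<And>b. \<exists>P. (\<forall>v\<in>boundary_vertices G. P v = 0) \<and>
      (\<forall>v\<in>interior_vertices G. (\<Sum>e\<in>parcs G. edge_sign e v * (\<kappa> e * (P (snd e) - P (fst e)))) = b v) \<and>
      (\<forall>v. \<bar>P v\<bar> \<le> K * (\<Sum>w\<in>interior_vertices G. \<bar>b w\<bar>))"
proof -
  let ?S = "interior_vertices G"
  \<comment> \<open>The weighted Laplacian as incidence matrix times conductances times transposed
    incidence matrix; only its rows and columns at interior vertices are used.\<close>
  define M where "M = (\<lambda>v w. \<Sum>e\<in>parcs G. edge_sign e v * (\<kappa> e * edge_sign e w))"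
  have M: "(\<Sum>w\<in>?S. M v w * P w) = (\<Sum>e\<in>parcs G. edge_sign e v * (\<kappa> e * (P (snd e) - P (fst e))))"
    if "\<And>v. v \<notin> ?S \<Longrightarrow> P v = 0" for P v
  proof -
    have "(\<Sum>w\<in>?S. M v w * P w)
      = (\<Sum>e\<in>parcs G. edge_sign e v * (\<kappa> e * (\<Sum>w\<in>?S. edge_sign e w * P w)))"
      unfolding M_def sum_distrib_left sum_distrib_right by (subst sum.swap) (simp add: algebra_simps)
    also have "\<dots> = (\<Sum>e\<in>parcs G. edge_sign e v * (\<kappa> e * (P (snd e) - P (fst e))))"
    proof (rule sum.cong)
      fix e assume e: "e \<in> parcs G"
      have "(\<Sum>w\<in>?S. edge_sign e w * P w) = P (snd e) - P (fst e)"
        using that interior_subset by (intro sum_edge_sign[OF e]) auto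
      then show "edge_sign e v * (\<kappa> e * (\<Sum>w\<in>?S. edge_sign e w * P w))
        = edge_sign e v * (\<kappa> e * (P (snd e) - P (fst e)))"
        by (simp only:)
    qed simp
    finally show ?thesis .
  qed
  have "\<forall>w\<in>?S. x w = 0" if "\<And>v. v \<in> ?S \<Longrightarrow> (\<Sum>w\<in>?S. M v w * x w) = 0" for x
  proof -
    \<comment> \<open>Extension by zero makes a kernel vector of the interior system a potential
      satisfying the boundary condition.\<close>
    define P where "P = (\<lambda>v. if v \<in> ?S then x v else 0)"
    have "(\<Sum>w\<in>?S. M v w * P w) = 0" if "v \<in> ?S" for v
      using \<open>\<And>v. v \<in> ?S \<Longrightarrow> (\<Sum>w\<in>?S. M v w * x w) = 0\<close>[OF that] by (simp add: P_def)
    then have flux: "(\<Sum>e\<in>parcs G. edge_sign e v * (\<kappa> e * (P (snd e) - P (fst e)))) = 0" if "v \<in> ?S" for v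
      using that M[of P v] by (simp add: P_def)
    have "P v = 0" if "v \<in> pverts G" for v
      by (rule dirichlet_kernel[OF \<kappa> _ flux that]) (simp_all add: P_def boundary_vertices_def)
    then have "P w = 0" if "w \<in> ?S" for w
      using that interior_subset by blast
    then show ?thesis by (simp add: P_def)
  qed
  then obtain N where N: "\<And>b v. v \<in> ?S \<Longrightarrow> (\<Sum>w\<in>?S. M v w * (\<Sum>z\<in>?S. N w z * b z)) = b v"
    using finite_linear_system_right_inverse[OF finite_interior, of M] by blast
  \<comment> \<open>The sum of all absolute entries bounds each single entry of the right
    inverse.\<close>
  define K where "K = (\<Sum>v\<in>?S. \<Sum>w\<in>?S. \<bar>N v w\<bar>)"
  have K: "\<bar>N v w\<bar> \<le> K" if "v \<in> ?S" "w \<in> ?S" for v w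
  proof -
    have "\<bar>N v w\<bar> \<le> (\<Sum>w\<in>?S. \<bar>N v w\<bar>)"
      using finite_interior that by (intro member_le_sum) auto
    also have "\<dots> \<le> K"
      unfolding K_def using finite_interior that
      by (intro member_le_sum[of v ?S "\<lambda>v. \<Sum>w\<in>?S. \<bar>N v w\<bar>"]) (auto intro: sum_nonneg)
    finally show ?thesis .
  qed
  have "0 \<le> K" unfolding K_def by (intro sum_nonneg) auto
  then show thesis
  proof (rule that)
    fix b :: "'v \<Rightarrow> real"
    define P where "P = (\<lambda>v. if v \<in> ?S then (\<Sum>z\<in>?S. N v z * b z) else 0)"
    have "\<bar>P v\<bar> \<le> K * (\<Sum>w\<in>?S. \<bar>b w\<bar>)" for v
    proof (cases "v \<in> ?S")
      case True
      have "\<bar>P v\<bar> \<le> (\<Sum>z\<in>?S. \<bar>N v z * b z\<bar>)"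
        using True by (simp add: P_def)
      also have "\<dots> \<le> (\<Sum>z\<in>?S. K * \<bar>b z\<bar>)"
        using True K by (intro sum_mono) (simp add: abs_mult mult_right_mono)
      finally show ?thesis by (simp add: sum_distrib_left)
    qed (use \<open>0 \<le> K\<close> in \<open>auto simp: P_def intro!: mult_nonneg_nonneg sum_nonneg\<close>)
    moreover have "(\<Sum>e\<in>parcs G. edge_sign e v * (\<kappa> e * (P (snd e) - P (fst e)))) = b v" if "v \<in> ?S" for v
      using M[of P v] N[OF that, of b] by (simp add: P_def)
    ultimately show "\<exists>P. (\<forall>v\<in>boundary_vertices G. P v = 0) \<and>
      (\<forall>v\<in>?S. (\<Sum>e\<in>parcs G. edge_sign e v * (\<kappa> e * (P (snd e) - P (fst e)))) = b v) \<and>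
      (\<forall>v. \<bar>P v\<bar> \<le> K * (\<Sum>w\<in>?S. \<bar>b w\<bar>))"
      by (intro exI[of _ P]) (auto simp: P_def boundary_vertices_def)
  qed
qed

end

subsection \<open>The stationary problem\<close>

lemma sum_LINT_square_nonneg:
  fixes w :: "'v \<times> 'v \<Rightarrow> real \<Rightarrow> real"
  shows "0 \<le> (\<Sum>e\<in>parcs G. LINT x|lebesgue_on {0..len e}. (w e x)\<^sup>2)"
  by (intro sum_nonneg) simp

lemma L2_norm_power2:
  "(L2_norm G len w)\<^sup>2 = (\<Sum>e\<in>parcs G. LINT x|lebesgue_on {0..len e}. (w e x)\<^sup>2)"
  using sum_LINT_square_nonneg[of len w G] by (simp add: L2_norm_def L2_inner_def power2_eq_square)

lemma L2_norm_nonneg: "0 \<le> L2_norm G len w"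
  using sum_LINT_square_nonneg[of len w G] by (simp add: L2_norm_def L2_inner_def power2_eq_square)

lemma L2_norm_cong_AE:
  assumes "v \<in> L2_network G len" "w \<in> L2_network G len"
    and "\<And>e. e \<in> parcs G \<Longrightarrow> AE x in lebesgue_on {0..len e}. v e x = w e x"
  shows "L2_norm G len v = L2_norm G len w"
proof -
  have "(LINT x|lebesgue_on {0..len e}. v e x * v e x) = (LINT x|lebesgue_on {0..len e}. w e x * w e x)"
    if e: "e \<in> parcs G" for e
  proof (rule integral_cong_AE)
    show "AE x in lebesgue_on {0..len e}. v e x * v e x = w e x * w e x"
      using assms(3)[OF e] by eventually_elim simp
  qed (use assms(1,2) e in \<open>auto simp: L2_network_def L2_interval_def\<close>)
  then show ?thesis by (simp add: L2_norm_def L2_inner_def)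
qed

lemma H1_norm_le: "H1_norm G len w \<le> L2_norm G len w + L2_norm G len (edgewise_deriv len w)"
  unfolding H1_norm_def by (intro sqrt_sum_squares_le_sum L2_norm_nonneg)

context network
begin

definition total_length :: real where
  "total_length = (\<Sum>e\<in>parcs G. len e)"

lemma total_length_nonneg: "0 \<le> total_length"
  unfolding total_length_def using len_pos by (intro sum_nonneg less_imp_le)

lemma len_le_total_length: "e \<in> parcs G \<Longrightarrow> len e \<le> total_length"
  unfolding total_length_def using len_pos pair_finite_arcs
  by (intro member_le_sum) (simp_all add: less_imp_le)

text \<open>Cauchy-Schwarz bounds the integral of \<open>\<bar>w e x\<bar>\<close> by
  \<open>sqrt (len e)\<close> times the L2 norm on the edge. Replacing \<open>len e\<close> by the
  total length makes the bound the same for all edges.\<close>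

lemma abs_primitive_le:
  assumes e: "e \<in> parcs G" and w: "w \<in> L2_network G len" and x: "x \<in> {0..len e}"
  shows "\<bar>primitive c (w e) x\<bar> \<le> \<bar>c\<bar> + sqrt total_length * L2_norm G len w"
proof -
  let ?M = "lebesgue_on {0..len e}"
  have we: "w e \<in> L2_interval (len e)" using w e by (simp add: L2_network_def)
  have "(LINT x|?M. (w e x)\<^sup>2) \<le> (L2_norm G len w)\<^sup>2"
    unfolding L2_norm_power2 using e pair_finite_arcs
    by (intro member_le_sum[of e _ "\<lambda>e. LINT x|lebesgue_on {0..len e}. (w e x)\<^sup>2"]) simp_all
  then have "(LINT x|?M. \<bar>w e x\<bar>)\<^sup>2 \<le> total_length * (L2_norm G len w)\<^sup>2"
    using len_le_total_length[OF e] len_pos[OF e]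
    by (intro order_trans[OF abs_integral_le_L2[OF len_pos[OF e] we]] mult_mono) simp_all
  then have "(LINT x|?M. \<bar>w e x\<bar>)\<^sup>2 \<le> (sqrt total_length * L2_norm G len w)\<^sup>2"
    by (simp add: power_mult_distrib total_length_nonneg)
  then have "(LINT x|?M. \<bar>w e x\<bar>) \<le> sqrt total_length * L2_norm G len w"
    by (rule power2_le_imp_le) (simp add: L2_norm_nonneg total_length_nonneg)
  moreover have "\<bar>integral {0..x} (w e)\<bar> \<le> (LINT x|?M. \<bar>w e x\<bar>)"
    by (rule abs_integral_Icc_le[OF L2_interval_integrable[OF we] x])
  ultimately show ?thesis
    unfolding primitive_def by linarith
qed

text \<open>The uniform pointwise bound is squared and integrated over the whole network, which
  yields the outer factor \<open>sqrt total_length\<close>.\<close>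

lemma L2_norm_primitive_le:
  assumes w: "w \<in> L2_network G len" and c: "\<And>e. e \<in> parcs G \<Longrightarrow> \<bar>c e\<bar> \<le> B" and "0 \<le> B"
  shows "L2_norm G len (\<lambda>e. primitive (c e) (w e))
    \<le> sqrt total_length * (B + sqrt total_length * L2_norm G len w)"
proof -
  define b where "b = B + sqrt total_length * L2_norm G len w"
  have "0 \<le> b"
    using \<open>0 \<le> B\<close> by (simp add: b_def L2_norm_nonneg total_length_nonneg)
  have "(LINT x|lebesgue_on {0..len e}. (primitive (c e) (w e) x)\<^sup>2) \<le> len e * b\<^sup>2"
    if e: "e \<in> parcs G" for e
  proof -
    have we: "w e \<in> L2_interval (len e)" using w e by (simp add: L2_network_def)
    have "(LINT x|lebesgue_on {0..len e}. (primitive (c e) (w e) x)\<^sup>2) \<le> (LINT x|lebesgue_on {0..len e}. b\<^sup>2)"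
    proof (rule integral_mono)
      show "integrable (lebesgue_on {0..len e}) (\<lambda>x. (primitive (c e) (w e) x)\<^sup>2)"
        using primitive_L2[OF we] by (simp add: L2_interval_def)
      fix x assume "x \<in> space (lebesgue_on {0..len e})"
      then have "\<bar>primitive (c e) (w e) x\<bar> \<le> b"
        using abs_primitive_le[OF e w, of x "c e"] c[OF e] by (simp add: b_def)
      then show "(primitive (c e) (w e) x)\<^sup>2 \<le> b\<^sup>2"
        using \<open>0 \<le> b\<close> by (simp add: abs_le_square_iff[symmetric])
    qed simp
    then show ?thesis using len_pos[OF e] by (simp add: measure_restrict_space)
  qed
  then have "(L2_norm G len (\<lambda>e. primitive (c e) (w e)))\<^sup>2 \<le> (\<Sum>e\<in>parcs G. len e * b\<^sup>2)"
    unfolding L2_norm_power2 by (rule sum_mono)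
  also have "\<dots> = (sqrt total_length * b)\<^sup>2"
    by (simp add: power_mult_distrib total_length_nonneg sum_distrib_right total_length_def[symmetric])
      (simp add: total_length_def sum_distrib_right)
  finally show ?thesis
    unfolding b_def[symmetric]
    by (rule power2_le_imp_le) (simp add: \<open>0 \<le> b\<close> total_length_nonneg)
qed

end

section \<open>Parametrization of solutions by vertex pressures\<close>

locale resistive_network = network G len for G :: "'v pair_pre_digraph" and len +
  fixes a :: "'v \<times> 'v \<Rightarrow> real \<Rightarrow> real" and C0 C1 :: real
  assumes a_L2: "a \<in> L2_network G len"
    and C0_pos: "0 < C0" and C1_pos: "0 < C1"
    and a_bounds: "e \<in> parcs G \<Longrightarrow> AE x in lebesgue_on {0..len e}. C0 \<le> a e x \<and> a e x \<le> C1"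
begin

text \<open>With an initial flow \<open>c\<close>, the equations on an edge integrate to a flow \<open>primitive c (g e)\<close>
  and a pressure with derivative \<open>slope f g c e\<close>.  The pressure at the head of the edge is affine
  in \<open>c\<close>, so \<open>c\<close> can be expressed by the two vertex pressures: this is \<open>inflow\<close>.\<close>

definition resistance :: "'v \<times> 'v \<Rightarrow> real" where
  "resistance e = integral {0..len e} (a e)"

definition slope where
  "slope f g c e x = f e x - a e x * primitive c (g e) x"

text \<open>The pressure difference, head minus tail, that the data produce on an edge with zero
  inflow: the constant term of the affine dependence on the inflow.\<close>

definition pressure_drop where
  "pressure_drop f g e = integral {0..len e} (slope f g 0 e)"

definition inflow where
  "inflow f g P e = (pressure_drop f g e - (P (snd e) - P (fst e))) / resistance e"

definition flow where
  "flow f g P = (\<lambda>e. primitive (inflow f g P e) (g e))"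

definition pressure where
  "pressure f g P = (\<lambda>e. primitive (P (fst e)) (slope f g (inflow f g P e) e))"

text \<open>The net flow into \<open>v\<close> that the data would cause if all vertex pressures
  were zero. On reaching its head an edge has gained the integral of \<open>g\<close>.\<close>

definition source where
  "source f g v = (\<Sum>e\<in>parcs G. edge_sign e v *
     (pressure_drop f g e / resistance e + (if snd e = v then integral {0..len e} (g e) else 0)))"

definition kirchhoff where
  "kirchhoff f g P \<longleftrightarrow> (\<forall>v\<in>boundary_vertices G. P v = 0) \<and>
     (\<forall>v\<in>interior_vertices G.
       (\<Sum>e\<in>parcs G. edge_sign e v * (1 / resistance e * (P (snd e) - P (fst e)))) = source f g v)"

lemma a_mult_L2:
  assumes "e \<in> parcs G" "w \<in> L2_interval (len e)"
  shows "(\<lambda>x. a e x * w x) \<in> L2_interval (len e)"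
proof (rule L2_interval_mult_bounded[OF _ _ assms(2)])
  show "a e \<in> borel_measurable (lebesgue_on {0..len e})"
    using a_L2 assms(1) by (simp add: L2_network_def L2_interval_def)
  show "AE x in lebesgue_on {0..len e}. \<bar>a e x\<bar> \<le> C1"
    using a_bounds[OF assms(1)] by eventually_elim (use C0_pos in linarith)
qed

lemma resistance_pos:
  assumes e: "e \<in> parcs G"
  shows "0 < resistance e"
proof -
  have i: "integrable (lebesgue_on {0..len e}) (a e)"
    using a_L2 e by (simp add: L2_network_def L2_interval_integrable)
  have "(LINT x|lebesgue_on {0..len e}. C0) \<le> (LINT x|lebesgue_on {0..len e}. a e x)"
    using a_bounds[OF e] by (intro integral_mono_AE i) (simp_all add: eventually_mono)
  then have "C0 * len e \<le> resistance e"
    using i len_pos[OF e] by (simp add: resistance_def lebesgue_integral_eq_integral measure_restrict_space mult.commute)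
  then show ?thesis
    using mult_pos_pos[OF C0_pos len_pos[OF e]] by linarith
qed

context
  fixes f g
  assumes f: "f \<in> L2_network G len" and g: "g \<in> L2_network G len"
begin

lemma f_L2: "e \<in> parcs G \<Longrightarrow> f e \<in> L2_interval (len e)"
  and g_L2: "e \<in> parcs G \<Longrightarrow> g e \<in> L2_interval (len e)"
  using f g by (simp_all add: L2_network_def)

lemma slope_L2: "e \<in> parcs G \<Longrightarrow> slope f g c e \<in> L2_interval (len e)"
  unfolding slope_def by (intro L2_interval_diff f_L2 a_mult_L2 primitive_L2 g_L2)

text \<open>The initial flow enters the flow as an additive constant, hence the pressure difference
  is affine in it with coefficient minus the resistance. Positive resistance then allows solving for
  it.\<close>

lemma integral_slope:
  assumes e: "e \<in> parcs G"
  shows "integral {0..len e} (slope f g c e) = pressure_drop f g e - c * resistance e"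
proof -
  have i: "slope f g 0 e integrable_on {0..len e}" "a e integrable_on {0..len e}"
    using slope_L2[OF e, of 0] a_L2 e
    by (simp_all add: L2_network_def L2_interval_integrable integrable_on_lebesgue_on)
  have "slope f g c e = (\<lambda>x. slope f g 0 e x - c * a e x)"
    by (simp add: fun_eq_iff slope_def primitive_def algebra_simps)
  moreover have "(\<lambda>x. c * a e x) integrable_on {0..len e}"
    using i(2) integrable_on_cmult_iff[of c "a e"] by (cases "c = 0") (simp_all add: integrable_0)
  ultimately show ?thesis
    using i(1) Henstock_Kurzweil_Integration.integral_diff[of "slope f g 0 e" "{0..len e}" "\<lambda>x. c * a e x"]
    by (simp add: pressure_drop_def resistance_def)
qed

lemma pressure_at_head:
  assumes e: "e \<in> parcs G"
  shows "pressure f g P e (len e) = P (snd e)"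
  using resistance_pos[OF e] by (simp add: pressure_def primitive_def integral_slope[OF e] inflow_def)

text \<open>Formulated for any edge values \<open>u\<close> of the required form, so that it applies
  both to the constructed flow and to the traces of an arbitrary solution.\<close>

lemma sum_flux:
  assumes u: "\<And>e. e \<in> incident_edges G v \<Longrightarrow>
      u e = inflow f g P e + (if snd e = v then integral {0..len e} (g e) else 0)"
  shows "(\<Sum>e\<in>incident_edges G v. edge_sign e v * u e)
    = source f g v - (\<Sum>e\<in>parcs G. edge_sign e v * (1 / resistance e * (P (snd e) - P (fst e))))"
proof -
  let ?u = "\<lambda>e. inflow f g P e + (if snd e = v then integral {0..len e} (g e) else 0)"
  have "(\<Sum>e\<in>incident_edges G v. edge_sign e v * u e) = (\<Sum>e\<in>incident_edges G v. edge_sign e v * ?u e)"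
    using u by (intro sum.cong) simp_all
  also have "\<dots> = (\<Sum>e\<in>parcs G. edge_sign e v * ?u e)"
    using pair_finite_arcs by (intro sum.mono_neutral_left) (auto simp: incident_edges_def edge_sign_def)
  also have "\<dots> = source f g v - (\<Sum>e\<in>parcs G. edge_sign e v * (1 / resistance e * (P (snd e) - P (fst e))))"
    unfolding source_def sum_subtractf[symmetric]
    by (intro sum.cong refl) (simp add: inflow_def divide_inverse algebra_simps)
  finally show ?thesis .
qed

lemma vertex_value_flow:
  assumes "e \<in> incident_edges G v"
  shows "vertex_value len (flow f g P) e v
    = inflow f g P e + (if snd e = v then integral {0..len e} (g e) else 0)"
proof -
  have e: "e \<in> parcs G" "fst e = v \<or> snd e = v" using assms by (simp_all add: incident_edges_def)
  show ?thesis
    using e(2) pair_no_loops[OF e(1)] len_pos[OF e(1)] interval_trace_primitive[OF len_pos g_L2, OF e(1) e(1)]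
    by (auto simp: vertex_value_def flow_def primitive_def)
qed

lemma vertex_value_pressure:
  assumes "e \<in> incident_edges G v"
  shows "vertex_value len (pressure f g P) e v = P v"
proof -
  have e: "e \<in> parcs G" "fst e = v \<or> snd e = v" using assms by (simp_all add: incident_edges_def)
  have "interval_trace (len e) (pressure f g P e) x = pressure f g P e x" if "x \<in> {0..len e}" for x
    unfolding pressure_def using e(1) that by (intro interval_trace_primitive len_pos slope_L2)
  then show ?thesis
    using e(2) pair_no_loops[OF e(1)] len_pos[OF e(1)] pressure_at_head[OF e(1), of P]
    by (auto simp: vertex_value_def pressure_def)
qed

lemma edgewise_deriv_flow:
  "e \<in> parcs G \<Longrightarrow> AE x in lebesgue_on {0..len e}. edgewise_deriv len (flow f g P) e x = g e x"
  unfolding edgewise_deriv_def flow_def by (intro weak_deriv_primitive len_pos g_L2)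

lemma edgewise_deriv_pressure:
  "e \<in> parcs G \<Longrightarrow> AE x in lebesgue_on {0..len e}.
    edgewise_deriv len (pressure f g P) e x = slope f g (inflow f g P e) e x"
  unfolding edgewise_deriv_def pressure_def by (intro weak_deriv_primitive len_pos slope_L2)

lemma flow_H1: "flow f g P \<in> H1_network G len"
  by (simp add: H1_network_def flow_def primitive_H1 g_L2)

lemma pressure_H1: "pressure f g P \<in> H1_network G len"
  by (simp add: H1_network_def pressure_def primitive_H1 slope_L2)

text \<open>Pressure continuity is built into the parametrization, since both ends of each edge
  attain the prescribed vertex values; flux balance is the only condition that the linear system
  must supply.\<close>

lemma kirchhoff_imp_stationary_solution:
  assumes "kirchhoff f g P"
  shows "flow f g P \<in> Hdiv G len" "pressure f g P \<in> H10 G len"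
    "stationary_solution G len a f g (flow f g P) (pressure f g P)"
proof -
  have 1: "flux_balanced G len (flow f g P)"
    using assms sum_flux[OF vertex_value_flow] by (simp add: flux_balanced_def kirchhoff_def)
  have 2: "continuous_at_interior G len (pressure f g P)"
    by (simp add: continuous_at_interior_def vertex_value_pressure)
  have 3: "zero_at_boundary G len (pressure f g P)"
    using assms by (simp add: zero_at_boundary_def vertex_value_pressure kirchhoff_def)
  show "flow f g P \<in> Hdiv G len" "pressure f g P \<in> H10 G len"
    using 1 2 3 by (simp_all add: Hdiv_def H10_def flow_H1 pressure_H1)
  have "AE x in lebesgue_on {0..len e}. edgewise_deriv len (pressure f g P) e x + a e x * flow f g P e x = f e x"
    if "e \<in> parcs G" for e
    using edgewise_deriv_pressure[OF that, of P] by eventually_elim (simp add: slope_def flow_def)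
  then show "stationary_solution G len a f g (flow f g P) (pressure f g P)"
    using 1 2 3 edgewise_deriv_flow by (simp add: stationary_solution_def)
qed

text \<open>Vertex pressures are read off the traces of \<open>p\<close>, where continuity makes the
  choice of edge immaterial. The traces of \<open>p\<close> at both ends of an edge then force the
  initial flow to be \<open>inflow\<close>.\<close>

lemma stationary_solution_imp_kirchhoff:
  assumes u: "u \<in> Hdiv G len" and p: "p \<in> H10 G len" and sol: "stationary_solution G len a f g u p"
  obtains P where "kirchhoff f g P" "network_eq G len u (flow f g P)" "network_eq G len p (pressure f g P)"
proof -
  have cont: "continuous_at_interior G len p" and zero: "zero_at_boundary G len p"
    and flux: "flux_balanced G len u"
    using sol unfolding stationary_solution_def by blast+
  \<comment> \<open>A vertex without edges counts as a boundary vertex, so the default has to be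
    0.\<close>
  define P where "P = (\<lambda>v. if incident_edges G v = {} then 0
    else vertex_value len p (SOME e. e \<in> incident_edges G v) v)"
  have some: "(SOME e. e \<in> incident_edges G v) \<in> incident_edges G v" if "e \<in> incident_edges G v" for e v
    using that by (rule someI)
  have P0: "P v = 0" if "v \<in> boundary_vertices G" for v
    using zero that some[of _ v] by (auto simp: P_def zero_at_boundary_def)
  have P: "vertex_value len p e v = P v" if e: "e \<in> incident_edges G v" for e v
  proof (cases "v \<in> interior_vertices G")
    case True
    then have "vertex_value len p e v = vertex_value len p (SOME e. e \<in> incident_edges G v) v"
      using cont e some[OF e] unfolding continuous_at_interior_def by blast
    then show ?thesis using e by (auto simp: P_def)
  next
    case False
    then have "v \<in> boundary_vertices G"
      using e arc_fst_in_verts arc_snd_in_verts by (auto simp: boundary_vertices_def incident_edges_def)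
    then show ?thesis
      using zero e P0 by (simp add: zero_at_boundary_def)
  qed
  define c where "c = (\<lambda>e. interval_trace (len e) (u e) 0)"
  have u_rep: "AE x in lebesgue_on {0..len e}. u e x = primitive (c e) (g e) x"
    and u_tr: "x \<in> {0..len e} \<Longrightarrow> interval_trace (len e) (u e) x = primitive (c e) (g e) x"
    if e: "e \<in> parcs G" for e x
  proof -
    have "u e \<in> H1_interval (len e)" using u e by (simp add: Hdiv_def H1_network_def)
    moreover have "AE x in lebesgue_on {0..len e}. weak_deriv (len e) (u e) x = g e x"
      using sol e by (simp add: stationary_solution_def edgewise_deriv_def)
    ultimately show "AE x in lebesgue_on {0..len e}. u e x = primitive (c e) (g e) x"
      and "x \<in> {0..len e} \<Longrightarrow> interval_trace (len e) (u e) x = primitive (c e) (g e) x"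
      unfolding c_def by (rule H1_interval_primitive[OF len_pos[OF e] _ g_L2[OF e]])+
  qed
  have p_rep: "AE x in lebesgue_on {0..len e}. p e x = primitive (P (fst e)) (slope f g (c e) e) x"
    and p_tr: "interval_trace (len e) (p e) (len e) = primitive (P (fst e)) (slope f g (c e) e) (len e)"
    if e: "e \<in> parcs G" for e
  proof -
    have H1: "p e \<in> H1_interval (len e)" using p e by (simp add: H10_def H1_network_def)
    have "AE x in lebesgue_on {0..len e}. weak_deriv (len e) (p e) x + a e x * u e x = f e x"
      using sol e by (simp add: stationary_solution_def edgewise_deriv_def)
    then have *: "AE x in lebesgue_on {0..len e}. weak_deriv (len e) (p e) x = slope f g (c e) e x"
      using u_rep[OF e] by eventually_elim (simp add: slope_def)
    have P_fst: "P (fst e) = interval_trace (len e) (p e) 0"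
      using P[of e "fst e"] e by (simp add: incident_edges_def vertex_value_def)
    show "AE x in lebesgue_on {0..len e}. p e x = primitive (P (fst e)) (slope f g (c e) e) x"
      unfolding P_fst by (rule H1_interval_primitive(1)[OF len_pos[OF e] H1 slope_L2[OF e] *])
    show "interval_trace (len e) (p e) (len e) = primitive (P (fst e)) (slope f g (c e) e) (len e)"
      unfolding P_fst
      by (rule H1_interval_primitive(2)[OF len_pos[OF e] H1 slope_L2[OF e] *])
        (simp add: len_pos[OF e] less_imp_le)
  qed
  have c: "c e = inflow f g P e" if e: "e \<in> parcs G" for e
  proof -
    have "P (snd e) = interval_trace (len e) (p e) (len e)"
      using P[of e "snd e"] e pair_no_loops[OF e] by (simp add: incident_edges_def vertex_value_def)
    then have "P (snd e) = P (fst e) + (pressure_drop f g e - c e * resistance e)"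
      using p_tr[OF e] by (simp add: primitive_def integral_slope[OF e])
    then show ?thesis
      using resistance_pos[OF e] by (simp add: inflow_def field_simps)
  qed
  have u_vertex: "vertex_value len u e v = inflow f g P e + (if snd e = v then integral {0..len e} (g e) else 0)"
    if "e \<in> incident_edges G v" for e v
  proof -
    have e: "e \<in> parcs G" "fst e = v \<or> snd e = v" using that by (simp_all add: incident_edges_def)
    show ?thesis
      using e(2) pair_no_loops[OF e(1)] len_pos[OF e(1)] u_tr[OF e(1)]
      by (auto simp: vertex_value_def c[OF e(1)] primitive_def)
  qed
  have "kirchhoff f g P"
    using P0 flux sum_flux[OF u_vertex] by (simp add: kirchhoff_def flux_balanced_def)
  moreover have "network_eq G len u (flow f g P)"
    unfolding network_eq_def flow_def using u_rep c by simp
  moreover have "network_eq G len p (pressure f g P)"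
    unfolding network_eq_def pressure_def using p_rep c by simp
  ultimately show thesis by (rule that)
qed

lemma kirchhoff_unique:
  assumes "kirchhoff f g P" "kirchhoff f g Q" "v \<in> pverts G"
  shows "P v = Q v"
proof -
  have "P v - Q v = 0"
  proof (rule dirichlet_kernel[of "\<lambda>e. 1 / resistance e" "\<lambda>v. P v - Q v"])
    fix w assume w: "w \<in> interior_vertices G"
    have "(\<Sum>e\<in>parcs G. edge_sign e w * (1 / resistance e * (P (snd e) - Q (snd e) - (P (fst e) - Q (fst e)))))
      = (\<Sum>e\<in>parcs G. edge_sign e w * (1 / resistance e * (P (snd e) - P (fst e))))
        - (\<Sum>e\<in>parcs G. edge_sign e w * (1 / resistance e * (Q (snd e) - Q (fst e))))"
      unfolding sum_subtractf[symmetric] by (intro sum.cong refl) (simp add: algebra_simps diff_divide_distrib)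
    then show "(\<Sum>e\<in>parcs G. edge_sign e w * (1 / resistance e * (P (snd e) - Q (snd e) - (P (fst e) - Q (fst e))))) = 0"
      using assms(1,2) w by (simp add: kirchhoff_def)
  qed (use assms resistance_pos in \<open>simp_all add: kirchhoff_def\<close>)
  then show ?thesis by simp
qed

lemma kirchhoff_unique_flow_pressure:
  assumes "kirchhoff f g P" "kirchhoff f g Q" "e \<in> parcs G"
  shows "flow f g P e = flow f g Q e" "pressure f g P e = pressure f g Q e"
  using kirchhoff_unique[OF assms(1,2)] arc_fst_in_verts[OF assms(3)] arc_snd_in_verts[OF assms(3)]
  by (simp_all add: flow_def pressure_def inflow_def)

text \<open>The pointwise inequality (x - y)^2 \<le> 2 x^2 + 2 y^2 takes the place of Minkowski's
  inequality; the factor 2 in the bound absorbs the loss.\<close>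

lemma L2_norm_slope_le:
  "L2_norm G len (\<lambda>e. slope f g (c e) e)
    \<le> 2 * (L2_norm G len f + C1 * L2_norm G len (\<lambda>e. primitive (c e) (g e)))"
proof -
  let ?u = "\<lambda>e. primitive (c e) (g e)"
  have "(LINT x|lebesgue_on {0..len e}. (slope f g (c e) e x)\<^sup>2)
      \<le> 2 * (LINT x|lebesgue_on {0..len e}. (f e x)\<^sup>2) + 2 * C1\<^sup>2 * (LINT x|lebesgue_on {0..len e}. (?u e x)\<^sup>2)"
    if e: "e \<in> parcs G" for e
  proof -
    have i: "integrable (lebesgue_on {0..len e}) (\<lambda>x. (f e x)\<^sup>2)"
      "integrable (lebesgue_on {0..len e}) (\<lambda>x. (?u e x)\<^sup>2)"
      "integrable (lebesgue_on {0..len e}) (\<lambda>x. (slope f g (c e) e x)\<^sup>2)"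
      using f_L2[OF e] primitive_L2[OF g_L2[OF e]] slope_L2[OF e] by (simp_all add: L2_interval_def)
    have "(LINT x|lebesgue_on {0..len e}. (slope f g (c e) e x)\<^sup>2)
      \<le> (LINT x|lebesgue_on {0..len e}. 2 * (f e x)\<^sup>2 + 2 * C1\<^sup>2 * (?u e x)\<^sup>2)"
    proof (rule integral_mono_AE)
      show "AE x in lebesgue_on {0..len e}. (slope f g (c e) e x)\<^sup>2 \<le> 2 * (f e x)\<^sup>2 + 2 * C1\<^sup>2 * (?u e x)\<^sup>2"
        using a_bounds[OF e]
      proof eventually_elim
        case (elim x)
        have "0 \<le> (f e x + a e x * ?u e x)\<^sup>2" by simp
        then have "(slope f g (c e) e x)\<^sup>2 \<le> 2 * (f e x)\<^sup>2 + 2 * ((a e x)\<^sup>2 * (?u e x)\<^sup>2)"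
          by (simp add: slope_def power2_sum power2_diff power_mult_distrib)
        moreover have "(a e x)\<^sup>2 * (?u e x)\<^sup>2 \<le> C1\<^sup>2 * (?u e x)\<^sup>2"
          using elim C0_pos by (intro mult_right_mono power_mono) auto
        ultimately show ?case by simp
      qed
    qed (use i in simp_all)
    also have "\<dots> = 2 * (LINT x|lebesgue_on {0..len e}. (f e x)\<^sup>2) + 2 * C1\<^sup>2 * (LINT x|lebesgue_on {0..len e}. (?u e x)\<^sup>2)"
      using i by simp
    finally show ?thesis .
  qed
  then have "(L2_norm G len (\<lambda>e. slope f g (c e) e))\<^sup>2 \<le> 2 * (L2_norm G len f)\<^sup>2 + 2 * C1\<^sup>2 * (L2_norm G len ?u)\<^sup>2"
    unfolding L2_norm_power2 sum_distrib_left sum.distrib[symmetric] by (rule sum_mono)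
  also have "\<dots> \<le> (2 * (L2_norm G len f + C1 * L2_norm G len ?u))\<^sup>2"
    using C1_pos by (simp add: power2_sum power_mult_distrib L2_norm_nonneg)
  finally show ?thesis
    by (rule power2_le_imp_le) (simp add: L2_norm_nonneg less_imp_le[OF C1_pos])
qed

end

theorem well_posed:
  "\<exists>C::real. \<forall>f \<in> L2_network G len. \<forall>g \<in> L2_network G len.
    \<exists>u \<in> Hdiv G len. \<exists>p \<in> H10 G len.
      stationary_solution G len a f g u p \<and>
      (\<forall>u' \<in> Hdiv G len. \<forall>p' \<in> H10 G len. stationary_solution G len a f g u' p' \<longrightarrow>
         network_eq G len u' u \<and> network_eq G len p' p) \<and>
      Hdiv_norm G len u + H1_norm G len p \<le> C * (L2_norm G len f + L2_norm G len g)"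
proof -
  let ?S = "interior_vertices G"
  obtain K where "0 \<le> K" and K: "\<And>b. \<exists>P. (\<forall>v\<in>boundary_vertices G. P v = 0) \<and>
      (\<forall>v\<in>?S. (\<Sum>e\<in>parcs G. edge_sign e v * (1 / resistance e * (P (snd e) - P (fst e)))) = b v) \<and>
      (\<forall>v. \<bar>P v\<bar> \<le> K * (\<Sum>w\<in>?S. \<bar>b w\<bar>))"
    using dirichlet_solution[of "\<lambda>e. 1 / resistance e"] resistance_pos by auto
  \<comment> \<open>\<open>s\<close> is the cost of one integration and \<open>r\<close> bounds
    every conductance. Relative to the size of the data, \<open>D\<close> bounds
    \<open>pressure_drop\<close>, \<open>KP\<close> the vertex pressures, \<open>KI\<close> the
    inflows, \<open>KU\<close> the norm of the flow and \<open>KS\<close> that of the pressure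
    derivative. All are fixed before \<open>f\<close> and \<open>g\<close>.\<close>
  define s where "s = sqrt total_length"
  define r where "r = (\<Sum>e\<in>parcs G. 1 / resistance e)"
  define D where "D = s * (2 * (1 + C1 * (s * s)))"
  define KP where "KP = K * (card ?S * (card (parcs G) * (r * D + s)))"
  define KI where "KI = r * (D + 2 * KP)"
  define KU where "KU = s * (KI + s)"
  define KS where "KS = 2 * (1 + C1 * KU)"
  have s: "0 \<le> s" and r: "0 \<le> r"
    using total_length_nonneg resistance_pos unfolding s_def r_def
    by (simp, intro sum_nonneg) (simp add: less_imp_le)
  have D: "0 \<le> D" using s C1_pos by (simp add: D_def)
  have KP: "0 \<le> KP" using s r D \<open>0 \<le> K\<close> by (simp add: KP_def)
  have KI: "0 \<le> KI" using r D KP by (simp add: KI_def)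
  have KU: "0 \<le> KU" using s KI by (simp add: KU_def)
  have KS: "0 \<le> KS" using KU C1_pos by (simp add: KS_def)
  have r_ge: "1 / resistance e \<le> r" if "e \<in> parcs G" for e
    unfolding r_def using that pair_finite_arcs resistance_pos
    by (intro member_le_sum[of e _ "\<lambda>e. 1 / resistance e"]) (simp_all add: less_imp_le)
  show ?thesis
  \<comment> \<open>In order, the summands account for the flow, its derivative (which is
    \<open>g\<close>), the pressure and its derivative.\<close>
  proof (intro exI[of _ "KU + 1 + (s * (KP + s * KS) + KS)"] ballI)
    fix f g assume f: "f \<in> L2_network G len" and g: "g \<in> L2_network G len"
    note fg = f g
    define N where "N = L2_norm G len f + L2_norm G len g"
    have N: "0 \<le> N" and fN: "L2_norm G len f \<le> N" and gN: "L2_norm G len g \<le> N"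
      by (simp_all add: N_def L2_norm_nonneg)
    obtain P where P0: "\<forall>v\<in>boundary_vertices G. P v = 0"
      and P: "\<forall>v\<in>?S. (\<Sum>e\<in>parcs G. edge_sign e v * (1 / resistance e * (P (snd e) - P (fst e)))) = source f g v"
      and P_le: "\<And>v. \<bar>P v\<bar> \<le> K * (\<Sum>w\<in>?S. \<bar>source f g w\<bar>)"
      using K[of "source f g"] by blast
    have kirchhoff: "kirchhoff f g P"
      using P0 P by (simp add: kirchhoff_def)
    have slope_net: "(\<lambda>e. slope f g (c e) e) \<in> L2_network G len" for c
      using slope_L2[OF fg] by (simp add: L2_network_def)
    have drop_le: "\<bar>pressure_drop f g e\<bar> \<le> D * N" if e: "e \<in> parcs G" for e
    proof -
      \<comment> \<open>Reading the integral as the end value of a primitive starting at 0 makes the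
        pointwise bound applicable.\<close>
      have "\<bar>pressure_drop f g e\<bar> = \<bar>primitive 0 (slope f g 0 e) (len e)\<bar>"
        by (simp add: pressure_drop_def primitive_def)
      also have "\<dots> \<le> s * L2_norm G len (\<lambda>e. slope f g 0 e)"
        using abs_primitive_le[OF e slope_net[of "\<lambda>_. 0"], of "len e" 0] len_pos[OF e] by (simp add: s_def)
      also have "\<dots> \<le> s * (2 * (N + C1 * (s * (s * N))))"
      proof (intro mult_left_mono order_trans[OF L2_norm_slope_le[OF fg]] add_mono fN)
        have "L2_norm G len (\<lambda>e. primitive 0 (g e)) \<le> s * (s * L2_norm G len g)"
          using L2_norm_primitive_le[OF g, of "\<lambda>_. 0" 0] by (simp add: s_def)
        also have "\<dots> \<le> s * (s * N)"
          using s gN by (intro mult_left_mono)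
        finally show "L2_norm G len (\<lambda>e. primitive 0 (g e)) \<le> s * (s * N)" .
      qed (use s C1_pos in simp_all)
      also have "\<dots> = D * N" by (simp add: D_def algebra_simps)
      finally show ?thesis .
    qed
    have source_le: "\<bar>source f g v\<bar> \<le> card (parcs G) * (r * D + s) * N" for v
    proof -
      have "\<bar>source f g v\<bar> \<le> (\<Sum>e\<in>parcs G. (r * D + s) * N)"
        unfolding source_def
      proof (rule order_trans[OF sum_abs sum_mono])
        fix e assume e: "e \<in> parcs G"
        have "\<bar>edge_sign e v\<bar> \<le> 1" by (simp add: edge_sign_def)
        moreover have "\<bar>pressure_drop f g e / resistance e\<bar> \<le> r * (D * N)"
          using mult_mono[OF r_ge[OF e] drop_le[OF e]] r resistance_pos[OF e] by (simp add: abs_divide)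
        moreover have "\<bar>primitive 0 (g e) (len e)\<bar> \<le> s * L2_norm G len g"
          using abs_primitive_le[OF e g, of "len e" 0] len_pos[OF e] by (simp add: s_def)
        then have "\<bar>if snd e = v then integral {0..len e} (g e) else 0\<bar> \<le> s * N"
          using s gN mult_left_mono[OF gN s] N by (auto simp: primitive_def intro: order_trans)
        ultimately have "\<bar>edge_sign e v\<bar> * \<bar>pressure_drop f g e / resistance e + (if snd e = v then integral {0..len e} (g e) else 0)\<bar>
          \<le> 1 * (r * (D * N) + s * N)"
          by (intro mult_mono order_trans[OF abs_triangle_ineq] add_mono) simp_all
        then show "\<bar>edge_sign e v * (pressure_drop f g e / resistance e + (if snd e = v then integral {0..len e} (g e) else 0))\<bar>
          \<le> (r * D + s) * N"
          by (simp only: abs_mult distrib_right mult.assoc mult_1)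
      qed
      then show ?thesis by (simp add: algebra_simps)
    qed
    have P_le: "\<bar>P v\<bar> \<le> KP * N" for v
    proof -
      have "(\<Sum>w\<in>?S. \<bar>source f g w\<bar>) \<le> card ?S * (card (parcs G) * (r * D + s) * N)"
        using sum_mono[of ?S "\<lambda>w. \<bar>source f g w\<bar>", OF source_le] by simp
      from mult_left_mono[OF this \<open>0 \<le> K\<close>] P_le[of v] show ?thesis
        by (simp add: KP_def algebra_simps)
    qed
    have inflow_le: "\<bar>inflow f g P e\<bar> \<le> KI * N" if e: "e \<in> parcs G" for e
    proof -
      have "\<bar>pressure_drop f g e - (P (snd e) - P (fst e))\<bar> \<le> D * N + 2 * (KP * N)"
        using drop_le[OF e] P_le[of "snd e"] P_le[of "fst e"] by linarith
      from mult_mono[OF r_ge[OF e] this] show ?thesis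
        using r resistance_pos[OF e] by (simp add: inflow_def abs_divide KI_def algebra_simps)
    qed
    have flow_le: "L2_norm G len (flow f g P) \<le> KU * N"
    proof -
      have "L2_norm G len (flow f g P) \<le> s * (KI * N + s * L2_norm G len g)"
        using L2_norm_primitive_le[OF g, of "inflow f g P" "KI * N"] inflow_le KI N by (simp add: flow_def s_def)
      also have "\<dots> \<le> s * (KI * N + s * N)"
        using s gN by (intro mult_left_mono add_left_mono)
      finally show ?thesis by (simp add: KU_def algebra_simps)
    qed
    have slope_le: "L2_norm G len (\<lambda>e. slope f g (inflow f g P e) e) \<le> KS * N"
    proof -
      have "L2_norm G len (\<lambda>e. slope f g (inflow f g P e) e) \<le> 2 * (N + C1 * (KU * N))"
        using flow_le C1_pos fN
        by (intro order_trans[OF L2_norm_slope_le[OF fg]] mult_left_mono add_mono) (simp_all add: flow_def)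
      then show ?thesis by (simp add: KS_def algebra_simps)
    qed
    have pressure_le: "L2_norm G len (pressure f g P) \<le> s * (KP + s * KS) * N"
    proof -
      have "L2_norm G len (pressure f g P) \<le> s * (KP * N + s * L2_norm G len (\<lambda>e. slope f g (inflow f g P e) e))"
        using L2_norm_primitive_le[OF slope_net, of "\<lambda>e. P (fst e)" "KP * N"] P_le KP N
        by (simp add: pressure_def s_def)
      also have "\<dots> \<le> s * (KP * N + s * (KS * N))"
        using s slope_le by (intro mult_left_mono add_left_mono)
      finally show ?thesis by (simp add: algebra_simps)
    qed
    have deriv_net: "edgewise_deriv len w \<in> L2_network G len" if "w \<in> H1_network G len" for w
      using that by (simp add: H1_network_def L2_network_def edgewise_deriv_def weak_deriv_L2)
    have flow': "L2_norm G len (edgewise_deriv len (flow f g P)) \<le> N"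
      using L2_norm_cong_AE[OF deriv_net[OF flow_H1[OF fg]] g edgewise_deriv_flow[OF fg]] gN by simp
    have pressure': "L2_norm G len (edgewise_deriv len (pressure f g P)) \<le> KS * N"
      using L2_norm_cong_AE[OF deriv_net[OF pressure_H1[OF fg]] slope_net edgewise_deriv_pressure[OF fg]] slope_le by simp
    have "H1_norm G len (flow f g P) + H1_norm G len (pressure f g P)
      \<le> (KU * N + N) + (s * (KP + s * KS) * N + KS * N)"
      by (intro add_mono order_trans[OF H1_norm_le] flow_le flow' pressure_le pressure')
    then have bound: "H1_norm G len (flow f g P) + H1_norm G len (pressure f g P)
      \<le> (KU + 1 + (s * (KP + s * KS) + KS)) * (L2_norm G len f + L2_norm G len g)"
      by (simp add: N_def[symmetric] algebra_simps)
    \<comment> \<open>Any competitor comes from a potential solving the same linear system, and two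
      such potentials agree at all vertices.\<close>
    have unique: "network_eq G len u' (flow f g P) \<and> network_eq G len p' (pressure f g P)"
      if sol: "u' \<in> Hdiv G len" "p' \<in> H10 G len" "stationary_solution G len a f g u' p'" for u' p'
    proof -
      obtain Q where "kirchhoff f g Q" "network_eq G len u' (flow f g Q)" "network_eq G len p' (pressure f g Q)"
        using stationary_solution_imp_kirchhoff[OF fg sol] .
      then show ?thesis
        using kirchhoff_unique_flow_pressure[OF fg \<open>kirchhoff f g Q\<close> kirchhoff] by (simp add: network_eq_def)
    qed
    show "\<exists>u \<in> Hdiv G len. \<exists>p \<in> H10 G len.
      stationary_solution G len a f g u p \<and>
      (\<forall>u' \<in> Hdiv G len. \<forall>p' \<in> H10 G len. stationary_solution G len a f g u' p' \<longrightarrow>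
         network_eq G len u' u \<and> network_eq G len p' p) \<and>
      H1_norm G len u + H1_norm G len p \<le>
        (KU + 1 + (s * (KP + s * KS) + KS)) * (L2_norm G len f + L2_norm G len g)"
      by (rule bexI[of _ "flow f g P"], rule bexI[of _ "pressure f g P"])
        (use kirchhoff_imp_stationary_solution[OF fg kirchhoff] unique bound in blast)+
  qed
qed

end

theorem theorem3p4:
  fixes G :: "'v pair_pre_digraph"
    and len :: "'v \<times> 'v \<Rightarrow> real"
    and a b c :: "'v \<times> 'v \<Rightarrow> real \<Rightarrow> real"
    and C0 C1 :: real
  assumes "pair_digraph G"
    and "Digraph_Component.connected (with_proj G)"
    and "boundary_vertices G \<noteq> {}"
    and "\<And>e. e \<in> parcs G \<Longrightarrow> 0 < len e"
    and "a \<in> L2_network G len" and "b \<in> L2_network G len" and "c \<in> L2_network G len"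
    and "C0 > 0" and "C1 > 0"
    and "\<And>e. e \<in> parcs G \<Longrightarrow> AE x in lebesgue_on {0..len e}. C0 \<le> a e x \<and> a e x \<le> C1"
    and "\<And>e. e \<in> parcs G \<Longrightarrow> AE x in lebesgue_on {0..len e}. C0 \<le> b e x \<and> b e x \<le> C1"
    and "\<And>e. e \<in> parcs G \<Longrightarrow> AE x in lebesgue_on {0..len e}. C0 \<le> c e x \<and> c e x \<le> C1"
  shows "\<exists>C::real. \<forall>f \<in> L2_network G len. \<forall>g \<in> L2_network G len.
    \<exists>u \<in> Hdiv G len. \<exists>p \<in> H10 G len.
      stationary_solution G len a f g u p \<and>
      (\<forall>u' \<in> Hdiv G len. \<forall>p' \<in> H10 G len. stationary_solution G len a f g u' p' \<longrightarrow>
         network_eq G len u' u \<and> network_eq G len p' p) \<and>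
      Hdiv_norm G len u + H1_norm G len p \<le> C * (L2_norm G len f + L2_norm G len g)"
proof -
  interpret resistive_network G len a C0 C1
    unfolding resistive_network_def resistive_network_axioms_def network_def network_axioms_def
    by (intro conjI allI impI assms)
  show ?thesis by (rule well_posed)
qed

end
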